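(* Let $(x,\rho):\mathbb{Z}^2\times\{0,1\}\to\mathbb{R}^3\times\mathbb{R}$ be a crisscrossed A-net. Then $(x,\rho)$ encodes a Weingarten pair of pre-hyperbolic nets (i.e. the layers $(x,\rho)(\cdot,0)$ and $(x,\rho)(\cdot,1)$ are pre-hyperbolic nets forming a Weingarten pair) if and only if there exists a Lelieuvre normal field $n$ of $x$ such that $\tau=\rho$ parametrizes either the Moutard coefficients $(a^{21},a^{23},a^{31})$ or the Moutard coefficients $(a^{12},a^{32},a^{13})$ of $n$; that is, either for all $(i,j)\in\{(2,1),(2,3),(3,1)\}$, or for all $(i,j)\in\{(1,2),(3,2),(1,3)\}$, one has $$a^{ij}=\frac{\rho_i\rho_j}{\rho\,\rho_{ij}}$$ on all elementary quadrilaterals of the $(i,j)$-coordinate planes of $\mathbb{Z}^2\times\{0,1\}$.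
   Context: Lower indices denote shifts: $\phi_i(z)=\phi(z+e_i)$, $\phi_{ij}(z)=\phi(z+e_i+e_j)$. $\operatorname{inc}[\cdot]$ denotes the subspace spanned by the given points; $\mathbb{R}^3$ is regarded as the affine part of $\mathbb{R}\mathrm{P}^3$. A-net: a map $x$ from the lattice to $\mathbb{R}^3$ such that every point is coplanar with all its lattice neighbours. Standing genericity assumption: elementary quadrilaterals are skew (non-coplanar) and every vertex star (also within each layer $\mathbb{Z}^2\times\{k\}$) spans a unique plane. On $\mathbb{Z}^2$ an A-net is called an A-surface. Lelieuvre normal field of $x$: a map $n$ from the lattice to $\mathbb{R}^3$ with $x_i-x=n_i\times n$ for all lattice directions $i$. Then $n_{ij}-n=a^{ij}(n_j-n_i)$ for $i\ne j$ with nonzero scalars $a^{ij}=-a^{ji}$ attached to elementary quadrilaterals, the Moutard coefficients. ($n$ is unique up to multiplying by $\alpha$ on the even and $1/\alpha$ on the odd sublattice, $\alpha\ne0$.) Cross: a cross adapted to a skew quadrilateral $(x_1,x_2,x_3,x_4)$ is a quadruple of coplanar points $p_{12},p_{23},p_{34},p_{41}$ with $p_{ij}$ on the line $\operatorname{inc}[x_i,x_j]$, different from $x_i,x_j$. It determines the unique doubly ruled quadric (hyperboloid) containing the four extended edges and the lines $\operatorname{inc}[p_{12},p_{34}]$, $\operatorname{inc}[p_{23},p_{41}]$. Crisscrossed A-net $(x,\rho)$: an A-net $x$ with a nowhere vanishing real function $\rho$ on the vertices; on each extended edge with endpoints $x(z),x(z')$ it defines the cross vertex $\frac{\rho(z)x(z)+\rho(z')x(z')}{\rho(z)+\rho(z')}$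 (point at infinity if the denominator vanishes), and on each elementary quadrilateral the four cross vertices form a cross. $C^1$-condition for two edge-adjacent quadrilaterals with crosses: the corresponding hyperboloids have the same tangent planes along the common edge line (equivalently, the endpoints of the common edge and the two cross vertices on the edges opposite to it are coplanar). A pre-hyperbolic net is a crisscrossed A-surface satisfying the $C^1$-condition for any two edge-adjacent quadrilaterals. Weingarten cube: a combinatorial cube with faces $(x_1,\dots,x_4)$, $(\tilde x_1,\dots,\tilde x_4)$, $(x_i,x_{i+1},\tilde x_{i+1},\tilde x_i)$, all skew, with planar vertex stars, and with crosses $(p_{ij})$, $(\tilde p_{ij})$ adapted to $(x_1,\dots,x_4)$ and $(\tilde x_1,\dots,\tilde x_4)$ such that for all $i$ and $(j,k,l)=(i+1,i+2,i+3)$ modulo 4, $\operatorname{inc}[p_{ij},\tilde p_{ij}]=\operatorname{inc}[x_i,x_j,p_{kl}]\cap\operatorname{inc}[\tilde x_i,\tilde x_j,\tilde p_{kl}]$. Two pre-hyperbolic nets $(x,\rho)$, $(\tilde x,\tilde\rho)$ on $\mathbb{Z}^2$ form a Weingarten pair if $x,\tilde x$ form a discrete Weingarten pair (i.e. the two layers together form an A-net on $\mathbb{Z}^2\times\{0,1\}$) and any two corresponding quadrilaterals with their crosses are opposite faces of a Weingarten cube. *)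

theory Defs
  imports "HOL-Analysis.Analysis"
begin

subsection \<open>Projective space\<close>

text \<open>
  A point of real projective 3-space is given by a nonzero vector of homogeneous coordinates
  in \<^typ>\<open>(real^3) \<times> real\<close>, and a projective subspace by the linear subspace formed by the
  representatives of its points together with 0, so that projective dimension is linear dimension
  minus one. The affine part is embedded by last coordinate 1; vectors with last coordinate 0
  are the points at infinity.
\<close>

type_synonym hpoint = "(real^3) \<times> real"

definition homog :: "real^3 \<Rightarrow> hpoint" where
  "homog a = (a, 1)"

definition inc :: "hpoint set \<Rightarrow> hpoint set" where
  "inc S = span S"

definition hcoplanar :: "hpoint set \<Rightarrow> bool" where
  "hcoplanar S \<longleftrightarrow> dim S \<le> 3"


subsection \<open>Quadrilaterals with crosses and their hyperboloids\<close>

text \<open>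
  The vertices of a quadrilateral are indexed cyclically by the type \<^typ>\<open>4\<close>, whose arithmetic
  is modulo 4. Edge \<open>i\<close> joins the vertices \<open>i\<close> and \<open>i + 1\<close>, and \<open>p i\<close> is the point of a cross
  on that edge.
\<close>

definition skew_quad :: "(4 \<Rightarrow> real^3) \<Rightarrow> bool" where
  "skew_quad q \<longleftrightarrow> \<not> coplanar (range q)"

definition adapted_cross :: "(4 \<Rightarrow> real^3) \<Rightarrow> (4 \<Rightarrow> hpoint) \<Rightarrow> bool" where
  "adapted_cross q p \<longleftrightarrow> skew_quad q \<and>
     (\<forall>i. p i \<in> inc {homog (q i), homog (q (i + 1))} \<and>
          p i \<notin> inc {homog (q i)} \<and> p i \<notin> inc {homog (q (i + 1))}) \<and>
     hcoplanar (range p)"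

text \<open>Quadrics are given by symmetric bilinear forms, which they determine up to a scalar.\<close>

definition quadric :: "(hpoint \<Rightarrow> hpoint \<Rightarrow> real) \<Rightarrow> hpoint set" where
  "quadric B = {v. B v v = 0}"

definition tangent_plane :: "(hpoint \<Rightarrow> hpoint \<Rightarrow> real) \<Rightarrow> hpoint \<Rightarrow> hpoint set" where
  "tangent_plane B v = {w. B v w = 0}"

text \<open>
  A nondegenerate real quadric in projective 3-space that contains a line has signature (2,2)
  and is doubly ruled.
\<close>

definition hyperboloid :: "(hpoint \<Rightarrow> hpoint \<Rightarrow> real) \<Rightarrow> bool" where
  "hyperboloid B \<longleftrightarrow> bilinear B \<and> (\<forall>u v. B u v = B v u) \<and>
     (\<forall>u. (\<forall>v. B u v = 0) \<longrightarrow> u = 0) \<and>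
     (\<exists>L. subspace L \<and> dim L = 2 \<and> L \<subseteq> quadric B)"

definition cross_hyperboloid ::
  "(4 \<Rightarrow> real^3) \<Rightarrow> (4 \<Rightarrow> hpoint) \<Rightarrow> (hpoint \<Rightarrow> hpoint \<Rightarrow> real) \<Rightarrow> bool" where
  "cross_hyperboloid q p B \<longleftrightarrow> hyperboloid B \<and>
     (\<forall>i. inc {homog (q i), homog (q (i + 1))} \<subseteq> quadric B) \<and>
     inc {p 0, p 2} \<subseteq> quadric B \<and> inc {p 1, p 3} \<subseteq> quadric B"

text \<open>
  The form \<open>B\<close> of the hyperboloid of a skew quadrilateral with cross exists and is unique up to a
  nonzero scalar, so tangent planes do not depend on the choice. Below, \<open>a\<close> and \<open>b\<close> are the
  endpoints of the edge shared by the two quadrilaterals.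
\<close>

definition C1_condition ::
  "real^3 \<Rightarrow> real^3 \<Rightarrow> (4 \<Rightarrow> real^3) \<Rightarrow> (4 \<Rightarrow> hpoint) \<Rightarrow> (4 \<Rightarrow> real^3) \<Rightarrow> (4 \<Rightarrow> hpoint) \<Rightarrow> bool"
  where
  "C1_condition a b q p q' p' \<longleftrightarrow>
     (\<exists>B B'. cross_hyperboloid q p B \<and> cross_hyperboloid q' p' B' \<and>
       (\<forall>v \<in> inc {homog a, homog b}. v \<noteq> 0 \<longrightarrow> tangent_plane B v = tangent_plane B' v))"

definition weingarten_cube ::
  "(4 \<Rightarrow> real^3) \<Rightarrow> (4 \<Rightarrow> hpoint) \<Rightarrow> (4 \<Rightarrow> real^3) \<Rightarrow> (4 \<Rightarrow> hpoint) \<Rightarrow> bool" where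
  "weingarten_cube q p q' p' \<longleftrightarrow>
     skew_quad q \<and> skew_quad q' \<and>
     (\<forall>i. \<not> coplanar {q i, q (i + 1), q' (i + 1), q' i}) \<and>
     (\<forall>i. coplanar {q i, q (i - 1), q (i + 1), q' i} \<and>
          coplanar {q' i, q' (i - 1), q' (i + 1), q i}) \<and>
     adapted_cross q p \<and> adapted_cross q' p' \<and>
     (\<forall>i. inc {p i, p' i} =
          inc {homog (q i), homog (q (i + 1)), p (i + 2)} \<inter>
          inc {homog (q' i), homog (q' (i + 1)), p' (i + 2)})"


subsection \<open>Lattices\<close>

text \<open>
  All lattices are subsets of \<open>\<int>\<^sup>3\<close>; a net on a lattice \<open>D\<close> is a function on \<open>\<int>\<^sup>3\<close> of which only the
  values on \<open>D\<close> matter. Thus \<open>layer k\<close> is \<open>\<int>\<^sup>2 \<times> {k}\<close>, i.e. a copy of \<open>\<int>\<^sup>2\<close>, and \<open>two_layers\<close> is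
  \<open>\<int>\<^sup>2 \<times> {0, 1}\<close>.
\<close>

definition layer :: "int \<Rightarrow> (int^3) set" where
  "layer k = {z. z $ 3 = k}"

definition two_layers :: "(int^3) set" where
  "two_layers = {z. z $ 3 \<in> {0, 1}}"

definition dir :: "3 \<Rightarrow> int^3" where
  "dir i = axis i 1"

text \<open>The values at the corners 0, 1, 2, 3 are those written \<open>\<phi>\<close>, \<open>\<phi>\<^sub>i\<close>, \<open>\<phi>\<^sub>i\<^sub>j\<close>, \<open>\<phi>\<^sub>j\<close>.\<close>

definition corner :: "int^3 \<Rightarrow> 3 \<Rightarrow> 3 \<Rightarrow> 4 \<Rightarrow> int^3" where
  "corner z i j k =
     (if k = 0 then z else if k = 1 then z + dir i
      else if k = 2 then z + dir i + dir j else z + dir j)"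

definition elementary_quad :: "(int^3) set \<Rightarrow> int^3 \<Rightarrow> 3 \<Rightarrow> 3 \<Rightarrow> bool" where
  "elementary_quad D z i j \<longleftrightarrow> i \<noteq> j \<and> range (corner z i j) \<subseteq> D"

definition vertex_star :: "(int^3) set \<Rightarrow> (int^3 \<Rightarrow> real^3) \<Rightarrow> int^3 \<Rightarrow> (real^3) set" where
  "vertex_star D x z = x ` (insert z (D \<inter> (\<Union>i. {z + dir i, z - dir i})))"


subsection \<open>A-nets, crisscrossed A-nets and pre-hyperbolic nets\<close>

text \<open>
  The last three clauses are the standing genericity assumption: a set spans a unique plane iff
  its affine hull has dimension 2.
\<close>

definition A_net :: "(int^3) set \<Rightarrow> (int^3 \<Rightarrow> real^3) \<Rightarrow> bool" where
  "A_net D x \<longleftrightarrow>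
     (\<forall>z\<in>D. coplanar (vertex_star D x z)) \<and>
     (\<forall>z i j. elementary_quad D z i j \<longrightarrow> skew_quad (x \<circ> corner z i j)) \<and>
     (\<forall>z\<in>D. aff_dim (vertex_star D x z) = 2) \<and>
     (\<forall>z\<in>D. aff_dim (vertex_star (D \<inter> layer (z $ 3)) x z) = 2)"

text \<open>
  Homogeneous coordinates of \<open>(\<rho>(z) x(z) + \<rho>(z') x(z')) / (\<rho>(z) + \<rho>(z'))\<close>; the last coordinate
  is the denominator, so that the point at infinity is covered too.
\<close>

definition cross_vertex ::
  "(int^3 \<Rightarrow> real^3) \<Rightarrow> (int^3 \<Rightarrow> real) \<Rightarrow> int^3 \<Rightarrow> int^3 \<Rightarrow> hpoint" where
  "cross_vertex x \<rho> z z' = (\<rho> z *\<^sub>R x z + \<rho> z' *\<^sub>R x z', \<rho> z + \<rho> z')"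

definition quad_cross ::
  "(int^3 \<Rightarrow> real^3) \<Rightarrow> (int^3 \<Rightarrow> real) \<Rightarrow> int^3 \<Rightarrow> 3 \<Rightarrow> 3 \<Rightarrow> 4 \<Rightarrow> hpoint" where
  "quad_cross x \<rho> z i j k = cross_vertex x \<rho> (corner z i j k) (corner z i j (k + 1))"

definition crisscrossed_A_net ::
  "(int^3) set \<Rightarrow> (int^3 \<Rightarrow> real^3) \<Rightarrow> (int^3 \<Rightarrow> real) \<Rightarrow> bool" where
  "crisscrossed_A_net D x \<rho> \<longleftrightarrow> A_net D x \<and> (\<forall>z\<in>D. \<rho> z \<noteq> 0) \<and>
     (\<forall>z i j. elementary_quad D z i j \<longrightarrow>
        adapted_cross (x \<circ> corner z i j) (quad_cross x \<rho> z i j))"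

text \<open>
  Edge-adjacent quadrilaterals of \<open>\<int>\<^sup>2 \<times> {k}\<close> are those at \<open>z\<close> and \<open>z + dir j\<close>, with common edge
  from \<open>z + dir j\<close> to \<open>z + dir i + dir j\<close>, where \<open>{i, j} = {1, 2}\<close>.
\<close>

definition pre_hyperbolic_net ::
  "int \<Rightarrow> (int^3 \<Rightarrow> real^3) \<Rightarrow> (int^3 \<Rightarrow> real) \<Rightarrow> bool" where
  "pre_hyperbolic_net k x \<rho> \<longleftrightarrow> crisscrossed_A_net (layer k) x \<rho> \<and>
     (\<forall>z i j. elementary_quad (layer k) z i j \<and> elementary_quad (layer k) (z + dir j) i j \<longrightarrow>
        C1_condition (x (z + dir j)) (x (z + dir i + dir j))
          (x \<circ> corner z i j) (quad_cross x \<rho> z i j)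
          (x \<circ> corner (z + dir j) i j) (quad_cross x \<rho> (z + dir j) i j))"

definition weingarten_pair :: "(int^3 \<Rightarrow> real^3) \<Rightarrow> (int^3 \<Rightarrow> real) \<Rightarrow> bool" where
  "weingarten_pair x \<rho> \<longleftrightarrow>
     pre_hyperbolic_net 0 x \<rho> \<and> pre_hyperbolic_net 1 x \<rho> \<and> A_net two_layers x \<and>
     (\<forall>z\<in>layer 0. weingarten_cube
        (x \<circ> corner z 1 2) (quad_cross x \<rho> z 1 2)
        (x \<circ> corner (z + dir 3) 1 2) (quad_cross x \<rho> (z + dir 3) 1 2))"


subsection \<open>Lelieuvre normals and Moutard coefficients\<close>

definition lelieuvre_normal_field ::
  "(int^3) set \<Rightarrow> (int^3 \<Rightarrow> real^3) \<Rightarrow> (int^3 \<Rightarrow> real^3) \<Rightarrow> bool" where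
  "lelieuvre_normal_field D x n \<longleftrightarrow>
     (\<forall>z i. z \<in> D \<and> z + dir i \<in> D \<longrightarrow> x (z + dir i) - x z = cross3 (n (z + dir i)) (n z))"

text \<open>
  The scalar exists and is unique if \<open>n\<close> is a Lelieuvre normal field of an A-net with
  skew elementary quadrilaterals.
\<close>

definition moutard_coeff :: "(int^3 \<Rightarrow> real^3) \<Rightarrow> 3 \<Rightarrow> 3 \<Rightarrow> int^3 \<Rightarrow> real" where
  "moutard_coeff n i j z =
     (THE a. n (z + dir i + dir j) - n z = a *\<^sub>R (n (z + dir j) - n (z + dir i)))"

definition parametrizes_moutard ::
  "(int^3) set \<Rightarrow> (int^3 \<Rightarrow> real) \<Rightarrow> (int^3 \<Rightarrow> real^3) \<Rightarrow> (3 \<times> 3) set \<Rightarrow> bool" where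
  "parametrizes_moutard D \<tau> n I \<longleftrightarrow>
     (\<forall>(i, j)\<in>I. \<forall>z. elementary_quad D z i j \<longrightarrow>
        moutard_coeff n i j z =
          \<tau> (z + dir i) * \<tau> (z + dir j) / (\<tau> z * \<tau> (z + dir i + dir j)))"

end

theory Submission
  imports Defs
begin

text \<open>
  For a Lelieuvre normal field \<open>n\<close> let \<open>g\<^sup>i\<^sup>j = a\<^sup>i\<^sup>j \<rho> \<rho>\<^sub>i\<^sub>j / (\<rho>\<^sub>i \<rho>\<^sub>j)\<close>. Evaluating the tangent
  plane of one vertex at the opposite vertex shows that the $C^1$-condition across an edge says
  that the values of \<open>g\<close> on the two quadrilaterals are reciprocal. The condition on an edge of a
  Weingarten cube is the same condition for a layer face and a side face meeting there. Hence
  \<open>(x, \<rho>)\<close> is a Weingarten pair iff \<open>g\<^sup>1\<^sup>2\<close> is inverted along every lattice edge and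
  \<open>g\<^sup>1\<^sup>3 = - g\<^sup>2\<^sup>3 = g\<^sup>1\<^sup>2\<close>. Scaling the normals by \<open>1 / sqrt \<bar>g\<^sup>1\<^sup>2\<bar>\<close> then gives another
  Lelieuvre field, for which \<open>g\<^sup>1\<^sup>2\<close> is constant \<open>1\<close> or \<open>- 1\<close>; the two signs are the two
  parametrizations of the statement. Lelieuvre normals exist since the edge coefficients
  relating arbitrary normals satisfy a product closure condition on each quadrilateral.
\<close>

subsection \<open>Skew quadrilaterals with normals\<close>

text \<open>The planes at the two ends of a shared edge are among the dual coordinate forms of both
  adjacent faces. Every condition across that edge is compared in terms of these two planes, which
  is how statements about hyperboloids and spans shrink to one scalar per face. The price is
  orientation: rotating the vertices of a face by one step turns \<open>g\<close> into
  \<open>- 1 / g\<close>, and exchanging its two directions turns it into \<open>- g\<close>. Faces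
  are therefore functions on the cyclic type \<open>4\<close>, whose rotations and one reflection
  are treated once. As \<open>g\<^sup>j\<^sup>i = - g\<^sup>i\<^sup>j\<close>, the side relations
  say that the faces (1,2), (3,2), (1,3) at a lower vertex share one value; this is the origin of
  the index triples, and reversing all three pairs negates that value. The freedom in the normals,
  \<alpha> on one sublattice and 1/\<alpha> on the other, multiplies \<open>g\<close> by positive
  squares that alternate in the same way as a ratio inverted along edges. It can normalize the
  absolute value but never the sign, so two cases remain.\<close>

lemma four_numerals [simp]: "(4::4) = 0" "(5::4) = 1" "(6::4) = 2"
  by simp_all

lemma all_four: "(\<forall>k::4. P k) \<longleftrightarrow> P 0 \<and> P 1 \<and> P 2 \<and> P 3"
  using forall_4[of P] by auto

lemma four_arith [simp]:
  "(0::4) - 1 = 3" "(1::4) - 2 = 3" "(1::4) - 3 = 2" "- (1::4) = 3" "- (2::4) = 2"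
  by simp_all

lemma range_four: "range (f :: 4 \<Rightarrow> 'a) = {f 0, f 1, f 2, f 3}"
  unfolding UNIV_4 by auto

lemma sum_four: "sum f (UNIV::4 set) = f 0 + f 1 + f 2 + f 3"
  by (simp add: sum_4 add.commute add.left_commute)

section \<open>Coplanarity, normals and triple products\<close>

lemma coplanar_imp_hyperplane:
  fixes S :: "(real^3) set"
  assumes "coplanar S"
  obtains N c where "N \<noteq> 0" "\<And>p. p \<in> S \<Longrightarrow> N \<bullet> p = c"
proof -
  obtain u v w where S: "S \<subseteq> affine hull {u, v, w}"
    using assms by (auto simp: coplanar_def)
  have "dim {v - u, w - u} < DIM(real^3)"
    by (rule le_less_trans[OF dim_le_card[OF span_superset]]) (auto simp: card_insert_if)
  then obtain N where "N \<noteq> 0" and N: "span {v - u, w - u} \<subseteq> {y. N \<bullet> y = 0}"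
    using lowdim_subset_hyperplane by blast
  have "v - u \<in> {y. N \<bullet> y = 0}" "w - u \<in> {y. N \<bullet> y = 0}"
    using N by (auto intro: span_base)
  then have "{u, v, w} \<subseteq> {y. N \<bullet> y = N \<bullet> u}" by (auto simp: inner_diff_right)
  then have "S \<subseteq> {y. N \<bullet> y = N \<bullet> u}"
    using S hull_minimal[of "{u, v, w}" "{y. N \<bullet> y = N \<bullet> u}" affine] affine_hyperplane
    by blast
  with \<open>N \<noteq> 0\<close> show thesis by (intro that[of N "N \<bullet> u"]) auto
qed

text \<open>A level set of a nonzero functional has affine dimension 2, so an affine basis of
  \<open>S\<close> has at most three points, and these span a plane containing
  \<open>S\<close>.\<close>

lemma hyperplane_imp_coplanar:
  fixes S :: "(real^3) set"
  assumes "N \<noteq> 0" "\<And>p. p \<in> S \<Longrightarrow> N \<bullet> p = c"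
  shows "coplanar S"
proof -
  have "aff_dim S \<le> aff_dim {p. N \<bullet> p = c}"
    using assms by (intro aff_dim_subset) auto
  then have le: "aff_dim S \<le> 2"
    using aff_dim_hyperplane[OF \<open>N \<noteq> 0\<close>, of c] by simp
  obtain B where B: "\<not> affine_dependent B" "affine hull B = affine hull S"
      "of_nat (card B) = aff_dim S + 1"
    using aff_dim_basis_exists[of S] by metis
  then have "finite B" "card B \<le> 3"
    using le aff_independent_finite by auto
  then have "coplanar B" by (rule coplanar_small)
  then show ?thesis by (metis B(2) coplanar_affine_hull_coplanar)
qed

lemma triple_product_zero_imp_orthogonal:
  fixes u v w :: "real^3"
  assumes "u \<bullet> cross3 v w = 0"
  obtains N where "N \<noteq> 0" "N \<bullet> u = 0" "N \<bullet> v = 0" "N \<bullet> w = 0"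
proof -
  have "det (vector [u, v, w] :: real^3^3) = 0"
    using assms by (simp add: dot_cross_det)
  then have "\<not> invertible (vector [u, v, w] :: real^3^3)"
    using invertible_det_nz by blast
  then obtain N where "N \<noteq> 0" and N: "(vector [u, v, w] :: real^3^3) *v N = 0"
    by (metis invertible_left_inverse matrix_left_invertible_ker)
  have "N \<bullet> u = 0 \<and> N \<bullet> v = 0 \<and> N \<bullet> w = 0"
    using N by (simp add: vec_eq_iff forall_3 matrix_vector_mult_def inner_vec_def sum_3
        vector_3 mult.commute)
  with \<open>N \<noteq> 0\<close> show thesis using that by blast
qed

lemma skew_quad_shift: "skew_quad (\<lambda>k. q (k + c)) \<longleftrightarrow> skew_quad q"
proof -
  have "surj (\<lambda>k. k + c)"
    by (rule surjI[of _ "\<lambda>k. k - c"]) simp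
  then have "range (\<lambda>k. q (k + c)) = range q"
    unfolding image_image[of q "\<lambda>k. k + c" UNIV, symmetric] by simp
  then show ?thesis by (simp add: skew_quad_def)
qed

lemma skew_quad_normal_zero:
  assumes "skew_quad q" "N \<bullet> (q 1 - q 0) = 0" "N \<bullet> (q 2 - q 1) = 0" "N \<bullet> (q 3 - q 0) = 0"
  shows "N = 0"
proof (rule ccontr)
  assume "N \<noteq> 0"
  then have "coplanar (range q)"
    using assms(2-4) by (intro hyperplane_imp_coplanar[of N _ "N \<bullet> q 0"]) (auto simp: range_four inner_diff_right)
  with assms(1) show False by (simp add: skew_quad_def)
qed

lemma skew_quad_iff_triple:
  "skew_quad q \<longleftrightarrow> (q 1 - q 0) \<bullet> cross3 (q 2 - q 0) (q 3 - q 0) \<noteq> 0"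
proof
  assume skew: "skew_quad q"
  show "(q 1 - q 0) \<bullet> cross3 (q 2 - q 0) (q 3 - q 0) \<noteq> 0"
  proof
    assume "(q 1 - q 0) \<bullet> cross3 (q 2 - q 0) (q 3 - q 0) = 0"
    then obtain N where "N \<noteq> 0" "N \<bullet> (q 1 - q 0) = 0" "N \<bullet> (q 2 - q 0) = 0" "N \<bullet> (q 3 - q 0) = 0"
      by (rule triple_product_zero_imp_orthogonal)
    then have "coplanar (range q)"
      by (intro hyperplane_imp_coplanar[of N _ "N \<bullet> q 0"]) (auto simp: range_four inner_diff_right)
    with skew show False by (simp add: skew_quad_def)
  qed
next
  assume nz: "(q 1 - q 0) \<bullet> cross3 (q 2 - q 0) (q 3 - q 0) \<noteq> 0"
  show "skew_quad q"
    unfolding skew_quad_def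
  proof
    assume "coplanar (range q)"
    then obtain N c where "N \<noteq> 0" and N: "\<And>p. p \<in> range q \<Longrightarrow> N \<bullet> p = c"
      using coplanar_imp_hyperplane by metis
    then have *: "N \<bullet> (q 1 - q 0) = 0" "N \<bullet> (q 2 - q 0) = 0" "N \<bullet> (q 3 - q 0) = 0"
      by (simp_all add: inner_diff_right)
    \<comment> \<open>Expansion in the reciprocal basis: up to the triple product, \<open>N\<close>
      is recovered from its inner products with three edge and diagonal vectors, all of which vanish
      here.\<close>
    have "((q 1 - q 0) \<bullet> cross3 (q 2 - q 0) (q 3 - q 0)) *\<^sub>R N =
      (N \<bullet> (q 1 - q 0)) *\<^sub>R cross3 (q 2 - q 0) (q 3 - q 0)
      + (N \<bullet> (q 2 - q 0)) *\<^sub>R cross3 (q 3 - q 0) (q 1 - q 0)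
      + (N \<bullet> (q 3 - q 0)) *\<^sub>R cross3 (q 1 - q 0) (q 2 - q 0)"
      by (simp add: cross3_simps forall_3)
    then show False using * nz \<open>N \<noteq> 0\<close> by simp
  qed
qed

text \<open>Shaped so that the triple product of a Lelieuvre quadrilateral factors, with the
  determinant of three of its normals as one factor.\<close>

lemma cross_dot_cross_cross:
  fixes a b c w :: "real^3"
  shows "cross3 b a \<bullet> cross3 w (cross3 c a) = - (a \<bullet> w) * (a \<bullet> cross3 b c)"
  by (simp add: cross3_simps)

lemma cross_zero_imp_multiple:
  fixes u v :: "real^3"
  assumes "cross3 u v = 0" "v \<noteq> 0"
  obtains c where "u = c *\<^sub>R v"
proof -
  have "collinear {0, v, u}"
    using assms(1) by (metis cross_eq_0 insert_commute)
  then show thesis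
    using collinear_lemma[of v u] assms(2) that by (metis scaleR_zero_left)
qed

section \<open>Lelieuvre quadrilaterals and their Moutard coefficients\<close>

definition homog_quad :: "(4 \<Rightarrow> real^3) \<Rightarrow> 4 \<Rightarrow> hpoint" where
  "homog_quad q k = homog (q k)"

text \<open>The equation, in homogeneous coordinates, of the plane through \<open>a\<close> with
  normal \<open>m\<close>.\<close>

definition plane_form :: "real^3 \<Rightarrow> real^3 \<Rightarrow> hpoint \<Rightarrow> real" where
  "plane_form m a w = m \<bullet> fst w - snd w * (m \<bullet> a)"

lemma linear_plane_form: "linear (plane_form m a)"
  by (rule linearI) (auto simp: plane_form_def algebra_simps inner_right_distrib)

lemma plane_form_homog: "plane_form m a (homog b) = m \<bullet> (b - a)"
  by (simp add: plane_form_def homog_def inner_diff_right)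

text \<open>
  The relation \<open>q (k + 1) - q k = m (k + 1) \<times> m k\<close> is invariant under reversing the edge, so the
  structure has the full dihedral symmetry of the quadrilateral.
\<close>

definition lelieuvre_quad :: "(4 \<Rightarrow> real^3) \<Rightarrow> (4 \<Rightarrow> real^3) \<Rightarrow> bool" where
  "lelieuvre_quad q m \<longleftrightarrow> skew_quad q \<and> (\<forall>k. q (k + 1) - q k = cross3 (m (k + 1)) (m k))"

definition quad_moutard :: "(4 \<Rightarrow> real^3) \<Rightarrow> real" where
  "quad_moutard m = (THE a. m 2 - m 0 = a *\<^sub>R (m 3 - m 1))"

lemma lelieuvre_quad_shift:
  assumes "lelieuvre_quad q m"
  shows "lelieuvre_quad (\<lambda>k. q (k + c)) (\<lambda>k. m (k + c))"
proof -
  have "q (k + 1 + c) - q (k + c) = cross3 (m (k + 1 + c)) (m (k + c))" for k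
    using assms[unfolded lelieuvre_quad_def, THEN conjunct2, rule_format, of "k + c"]
    by (simp only: add_ac)
  then show ?thesis
    using assms by (simp add: lelieuvre_quad_def skew_quad_shift)
qed

text \<open>The reflection \<open>1 - k\<close> swaps the ends of edge 0. It serves faces that are
  traversed against the lattice directions.\<close>

lemma lelieuvre_quad_reflect:
  assumes "lelieuvre_quad q m"
  shows "lelieuvre_quad (\<lambda>k. q (1 - k)) (\<lambda>k. m (1 - k))"
proof -
  have "range (\<lambda>k. q (1 - k)) = range q"
    by (auto simp: range_four)
  moreover have "q (1 - (k + 1)) - q (1 - k) = cross3 (m (1 - (k + 1))) (m (1 - k))" for k
    using assms[unfolded lelieuvre_quad_def, THEN conjunct2, rule_format, of "- k"]
    by (metis (no_types, lifting) add.commute add_diff_cancel_left' cross_skew diff_add_eq_diff_diff_swap diff_minus_eq_add minus_diff_eq uminus_add_conv_diff)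
  ultimately show ?thesis
    using assms by (simp add: lelieuvre_quad_def skew_quad_def)
qed

text \<open>The edges sum to zero, and by the Lelieuvre relation their sum is, up to sign, the cross
  product of the two diagonals of the normals; so these are parallel. Skewness excludes
  degeneration: \<open>V\<close> is a factor of the triple product of the quadrilateral, and a zero
  coefficient would collapse the diagonal from \<open>q 0\<close> to \<open>q 2\<close>.\<close>

lemma lelieuvre_quad_moutard:
  assumes "lelieuvre_quad q m"
  defines "V \<equiv> m 0 \<bullet> cross3 (m 1) (m 3)"
  shows "V \<noteq> 0" "quad_moutard m \<noteq> 0" "m 2 - m 0 = quad_moutard m *\<^sub>R (m 3 - m 1)"
    "m 3 \<noteq> m 1"
proof -
  have e: "q 1 - q 0 = cross3 (m 1) (m 0)" "q 2 - q 1 = cross3 (m 2) (m 1)"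
      "q 3 - q 2 = cross3 (m 3) (m 2)" "q 0 - q 3 = cross3 (m 0) (m 3)"
    using assms(1)[unfolded lelieuvre_quad_def all_four] by simp_all
  have d3: "q 3 - q 0 = cross3 (m 3) (m 0)"
    using e(4) by (metis cross_skew minus_diff_eq)
  have d2: "q 2 - q 0 = cross3 (m 2 - m 0) (m 1)"
    using e(1,2) cross_skew[of "m 0" "m 1"]
    by (simp add: Cross3.left_diff_distrib algebra_simps flip: e(1,2))
  have "cross3 (m 2 - m 0) (m 3 - m 1) = 0"
  proof -
    have "cross3 (m 2 - m 0) (m 3 - m 1)
        = - ((q 1 - q 0) + (q 2 - q 1) + (q 3 - q 2) + (q 0 - q 3))"
      unfolding e cross_skew[of "m 3" "m 2"] cross_skew[of "m 1" "m 0"]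
      by (simp add: Cross3.left_diff_distrib Cross3.right_diff_distrib)
    then show ?thesis by simp
  qed
  have T: "(q 1 - q 0) \<bullet> cross3 (q 2 - q 0) (q 3 - q 0) = - (m 0 \<bullet> (q 2 - q 0)) * V"
    unfolding V_def e(1) d3 by (rule cross_dot_cross_cross)
  have nz: "(q 1 - q 0) \<bullet> cross3 (q 2 - q 0) (q 3 - q 0) \<noteq> 0"
    using assms(1) skew_quad_iff_triple lelieuvre_quad_def by blast
  with T show "V \<noteq> 0" by auto
  then show "m 3 \<noteq> m 1" by (auto simp: V_def)
  then obtain a where a: "m 2 - m 0 = a *\<^sub>R (m 3 - m 1)"
    using cross_zero_imp_multiple[OF \<open>cross3 (m 2 - m 0) (m 3 - m 1) = 0\<close>] by auto
  have eq: "quad_moutard m = a"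
    unfolding quad_moutard_def
  proof (rule the_equality)
    show "b = a" if "m 2 - m 0 = b *\<^sub>R (m 3 - m 1)" for b
      using that \<open>m 3 \<noteq> m 1\<close> a by simp
  qed (rule a)
  then show "m 2 - m 0 = quad_moutard m *\<^sub>R (m 3 - m 1)" using a by simp
  have "a \<noteq> 0"
  proof
    assume "a = 0"
    then have "q 2 - q 0 = 0" using a d2 by simp
    with nz show False by simp
  qed
  with eq show "quad_moutard m \<noteq> 0" by simp
qed

lemma quad_moutard_eqI:
  assumes "m 3 \<noteq> m 1" "m 2 - m 0 = a *\<^sub>R (m 3 - m 1)"
  shows "quad_moutard m = a"
  unfolding quad_moutard_def
  by (rule the_equality) (use assms in auto)

text \<open>A rotation exchanges the two diagonals of the normals and reverses one of them; the
  reflection below exchanges them without a sign.\<close>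

lemma quad_moutard_shift:
  assumes "lelieuvre_quad q m"
  shows "quad_moutard (\<lambda>k. m (k + 1)) = - 1 / quad_moutard m"
proof (rule quad_moutard_eqI)
  note M = lelieuvre_quad_moutard[OF assms]
  show "m (3 + 1) \<noteq> m (1 + 1)"
    using M(2-4) by auto
  show "m (2 + 1) - m (0 + 1) = (- 1 / quad_moutard m) *\<^sub>R (m (3 + 1) - m (1 + 1))"
    using M(2) arg_cong[OF M(3), of "\<lambda>v. (1 / quad_moutard m) *\<^sub>R v"]
    by (simp add: scaleR_right_diff_distrib)
qed

lemma quad_moutard_reflect:
  assumes "lelieuvre_quad q m"
  shows "quad_moutard (\<lambda>k. m (1 - k)) = 1 / quad_moutard m"
proof (rule quad_moutard_eqI)
  note M = lelieuvre_quad_moutard[OF assms]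
  show "m (1 - 3) \<noteq> m (1 - 1)"
    using M(2-4) by auto
  show "m (1 - 2) - m (1 - 0) = (1 / quad_moutard m) *\<^sub>R (m (1 - 3) - m (1 - 1))"
    using M(2) arg_cong[OF M(3), of "\<lambda>v. (1 / quad_moutard m) *\<^sub>R v"]
    by (simp add: scaleR_right_diff_distrib)
qed

section \<open>Dual coordinates and planes through an edge\<close>

definition dual_quad :: "(4 \<Rightarrow> hpoint) \<Rightarrow> (4 \<Rightarrow> hpoint \<Rightarrow> real) \<Rightarrow> bool" where
  "dual_quad X f \<longleftrightarrow> (\<forall>k. linear (f k)) \<and> (\<forall>k j. f k (X j) \<noteq> 0 \<longleftrightarrow> k = j)"

text \<open>The forms are dual to the vertices only up to nonzero factors, hence the quotients.
  Applying them to a vanishing combination shows that the four vertices are independent, so they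
  form a basis of the four-dimensional space, and both sides are linear and agree on it.\<close>

lemma dual_quad_expansion:
  assumes "dual_quad X f"
  shows "w = (\<Sum>k\<in>UNIV. (f k w / f k (X k)) *\<^sub>R X k)"
proof -
  have lin: "linear (f k)" and dual: "f k (X j) \<noteq> 0 \<longleftrightarrow> k = j" for k j
    using assms by (auto simp: dual_quad_def)
  have inj: "inj X"
    by (rule injI) (metis dual)
  have "independent (range X)"
  proof (rule independent_if_scalars_zero)
    fix g v assume 0: "(\<Sum>v\<in>range X. g v *\<^sub>R v) = 0" and "v \<in> range X"
    then obtain j where v: "v = X j" by auto
    have "(\<Sum>k\<in>UNIV. g (X k) *\<^sub>R X k) = 0"
      using 0 by (simp add: sum.reindex[OF inj])
    then have "f j (\<Sum>k\<in>UNIV. g (X k) *\<^sub>R X k) = 0"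
      using linear_0[OF lin] by simp
    then have "(\<Sum>k\<in>UNIV. g (X k) * f j (X k)) = 0"
      by (simp add: linear_sum[OF lin] linear_cmul[OF lin])
    moreover have "(\<Sum>k\<in>UNIV. g (X k) * f j (X k)) = (\<Sum>k\<in>{j}. g (X k) * f j (X k))"
      by (rule sum.mono_neutral_right) (use dual in auto)
    ultimately show "g v = 0"
      using dual[of j j] v by simp
  qed simp
  moreover have "card (range X) = 4"
    using inj by (simp add: card_image)
  ultimately have "UNIV \<subseteq> span (range X)"
    by (intro card_ge_dim_independent) (auto simp: dim_UNIV)
  then have "w \<in> span (range X)" by auto
  have "linear (\<lambda>w. \<Sum>k\<in>UNIV. (f k w / f k (X k)) *\<^sub>R X k)"
    by (rule linearI)
       (simp_all add: linear_add[OF lin] linear_cmul[OF lin] add_divide_distrib scaleR_add_left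
          sum.distrib scaleR_sum_right)
  moreover
  have "X j = (\<Sum>k\<in>UNIV. (f k (X j) / f k (X k)) *\<^sub>R X k)" for j
  proof -
    have "(\<Sum>k\<in>UNIV. (f k (X j) / f k (X k)) *\<^sub>R X k) = (\<Sum>k\<in>{j}. (f k (X j) / f k (X k)) *\<^sub>R X k)"
      by (rule sum.mono_neutral_right) (use dual in auto)
    then show ?thesis using dual[of j j] by simp
  qed
  then have "id v = (\<Sum>k\<in>UNIV. (f k v / f k (X k)) *\<^sub>R X k)" if "v \<in> range X" for v
    using that by auto
  ultimately show ?thesis
    using linear_eq_on_span[OF linear_id _ _ \<open>w \<in> span (range X)\<close>] by (metis (no_types, lifting) id_apply)
qed

text \<open>
  The tangent plane at a vertex contains all the other vertices except the opposite one; therefore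
  the plane at vertex \<open>k + 2\<close> yields the linear form dual to vertex \<open>k\<close>.
\<close>

definition dual_form :: "(4 \<Rightarrow> real^3) \<Rightarrow> (4 \<Rightarrow> real^3) \<Rightarrow> 4 \<Rightarrow> hpoint \<Rightarrow> real" where
  "dual_form q m k = plane_form (m (k + 2)) (q (k + 2))"

lemma dual_form_values:
  assumes "lelieuvre_quad q m"
  defines "V \<equiv> m 0 \<bullet> cross3 (m 1) (m 3)" and "a \<equiv> quad_moutard m"
  shows "dual_form q m 0 (homog (q 0)) = a * V" "dual_form q m 1 (homog (q 1)) = - V"
    "dual_form q m 2 (homog (q 2)) = - a * V" "dual_form q m 3 (homog (q 3)) = V"
    "dual_quad (homog_quad q) (dual_form q m)"
proof -
  note M = lelieuvre_quad_moutard[OF assms(1), folded V_def a_def]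
  have "q 1 - q 0 = cross3 (m 1) (m 0)" "q 2 - q 1 = cross3 (m 2) (m 1)" "q 0 - q 3 = cross3 (m 0) (m 3)"
    using assms(1)[unfolded lelieuvre_quad_def all_four] by simp_all
  then have e: "q 1 = cross3 (m 1) (m 0) + q 0" "q 2 = cross3 (m 2) (m 1) + q 1"
      "q 0 = cross3 (m 0) (m 3) + q 3"
    by (simp_all only: diff_eq_eq)
  \<comment> \<open>All points and normals are now expressed by \<open>q 0\<close> and the normals
    at 0, 1 and 3, so that each value becomes a multiple of \<open>V\<close>.\<close>
  have m2: "m 2 = m 0 + a *\<^sub>R (m 3 - m 1)"
    using M(3) by (simp add: algebra_simps)
  have q3: "q 3 = q 0 - cross3 (m 0) (m 3)"
    using e(3) by (metis add_diff_cancel_left')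
  have q2: "q 2 = q 0 + a *\<^sub>R cross3 (m 3) (m 1)"
    unfolding e(2) unfolding e(1) unfolding m2
    using cross_skew[of "m 0" "m 1"]
    by (simp add: cross_add_left cross_mult_left Cross3.left_diff_distrib)
  have defs: "dual_form q m 0 = plane_form (m 2) (q 2)" "dual_form q m 1 = plane_form (m 3) (q 3)"
      "dual_form q m 2 = plane_form (m 0) (q 0)" "dual_form q m 3 = plane_form (m 1) (q 1)"
    by (simp_all add: dual_form_def)
  note defs = defs plane_form_homog
  show v0: "dual_form q m 0 (homog (q 0)) = a * V"
    unfolding defs V_def q2 m2 by (simp add: cross3_simps)
  show v1: "dual_form q m 1 (homog (q 1)) = - V"
    unfolding defs V_def q3 e(1) by (simp add: cross3_simps)
  show v2: "dual_form q m 2 (homog (q 2)) = - a * V"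
    unfolding defs V_def q2 by (simp add: cross3_simps)
  show v3: "dual_form q m 3 (homog (q 3)) = V"
    unfolding defs V_def q3 e(1) by (simp add: cross3_simps)
  have 0: "m k \<bullet> (q k - q k) = 0" "m k \<bullet> (q (k + 1) - q k) = 0" "m (k + 1) \<bullet> (q k - q (k + 1)) = 0" for k
  proof -
    have "q (k + 1) - q k = cross3 (m (k + 1)) (m k)"
      using assms(1) by (simp add: lelieuvre_quad_def)
    then show "m k \<bullet> (q (k + 1) - q k) = 0" "m (k + 1) \<bullet> (q k - q (k + 1)) = 0"
      by (metis dot_cross_self(2)) (metis \<open>q (k + 1) - q k = cross3 (m (k + 1)) (m k)\<close>
          dot_cross_self(1) inner_minus_right minus_diff_eq minus_zero)
  qed simp
  have "dual_form q m k (homog_quad q j) \<noteq> 0 \<longleftrightarrow> k = j" for k j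
  proof -
    have "\<forall>k j. dual_form q m k (homog_quad q j) \<noteq> 0 \<longleftrightarrow> k = j"
      unfolding all_four
      using v0 v1 v2 v3 M(1,2) 0(2)[of 0] 0(2)[of 1] 0(2)[of 2] 0(2)[of 3]
        0(3)[of 0] 0(3)[of 1] 0(3)[of 2] 0(3)[of 3]
      by (simp add: homog_quad_def defs)
    then show ?thesis by blast
  qed
  then show "dual_quad (homog_quad q) (dual_form q m)"
    by (simp add: dual_quad_def dual_form_def linear_plane_form)
qed

definition cross_point :: "(4 \<Rightarrow> hpoint) \<Rightarrow> (4 \<Rightarrow> real) \<Rightarrow> 4 \<Rightarrow> hpoint" where
  "cross_point X r k = r k *\<^sub>R X k + r (k + 1) *\<^sub>R X (k + 1)"

text \<open>The coordinates at vertices 0 and 1 are free in this plane; those at 2 and 3 must be in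
  the ratio \<open>r 2 : r 3\<close> of the cross point.\<close>

lemma span_cross_point_iff:
  assumes "dual_quad X f" "r 2 \<noteq> 0" "r 3 \<noteq> 0"
  shows "w \<in> span {X 0, X 1, cross_point X r 2} \<longleftrightarrow>
    f 2 w * (r 3 * f 3 (X 3)) = f 3 w * (r 2 * f 2 (X 2))"
proof
  have lin: "linear (f k)" and dual: "f k (X j) \<noteq> 0 \<longleftrightarrow> k = j" for k j
    using assms by (auto simp: dual_quad_def)
  have ez: "f k (X j) = 0" if "k \<noteq> j" for k j using dual that by blast
  note ls = linear_add[OF lin] linear_cmul[OF lin] linear_diff[OF lin]
  {
    assume "w \<in> span {X 0, X 1, cross_point X r 2}"
    then obtain a b c where "w - a *\<^sub>R X 0 - b *\<^sub>R X 1 - c *\<^sub>R cross_point X r 2 = 0"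
      unfolding span_insert span_empty by auto
    then have w: "w = a *\<^sub>R X 0 + b *\<^sub>R X 1 + c *\<^sub>R cross_point X r 2"
      by (simp add: algebra_simps)
    show "f 2 w * (r 3 * f 3 (X 3)) = f 3 w * (r 2 * f 2 (X 2))"
      unfolding w cross_point_def by (simp add: ls ez)
  }
  assume eq: "f 2 w * (r 3 * f 3 (X 3)) = f 3 w * (r 2 * f 2 (X 2))"
  have nz: "f k (X k) \<noteq> 0" for k using dual by blast
  have "f 3 w / f 3 (X 3) = (f 2 w / (f 2 (X 2) * r 2)) * r 3"
    using eq nz[of 2] nz[of 3] assms(2,3) by (simp add: field_simps)
  then have "w = (f 0 w / f 0 (X 0)) *\<^sub>R X 0 + (f 1 w / f 1 (X 1)) *\<^sub>R X 1
       + (f 2 w / (f 2 (X 2) * r 2)) *\<^sub>R cross_point X r 2"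
    using dual_quad_expansion[OF assms(1), of w] assms(2)
    by (simp add: sum_four cross_point_def scaleR_add_right add.assoc)
  also have "\<dots> \<in> span {X 0, X 1, cross_point X r 2}"
    by (intro span_add span_scale span_base) auto
  finally show "w \<in> span {X 0, X 1, cross_point X r 2}" .
qed

text \<open>
  The Moutard coefficient divided by its value parametrized by \<open>r\<close>; the parametrization holds iff
  this is 1.
\<close>

definition quad_ratio :: "(4 \<Rightarrow> real^3) \<Rightarrow> (4 \<Rightarrow> real) \<Rightarrow> real" where
  "quad_ratio m r = quad_moutard m * (r 0 * r 2) / (r 1 * r 3)"

lemma quad_ratio_shift:
  assumes "lelieuvre_quad q m" "\<And>k. r k \<noteq> 0"
  shows "quad_ratio (\<lambda>k. m (k + 1)) (\<lambda>k. r (k + 1)) = - 1 / quad_ratio m r"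
  unfolding quad_ratio_def quad_moutard_shift[OF assms(1)]
  using lelieuvre_quad_moutard(2)[OF assms(1)] assms(2) by (simp add: field_simps)

lemma quad_ratio_reflect:
  assumes "lelieuvre_quad q m" "\<And>k. r k \<noteq> 0"
  shows "quad_ratio (\<lambda>k. m (1 - k)) (\<lambda>k. r (1 - k)) = 1 / quad_ratio m r"
  unfolding quad_ratio_def quad_moutard_reflect[OF assms(1)]
  using lelieuvre_quad_moutard(2)[OF assms(1)] assms(2) by (simp add: field_simps)

text \<open>In the coordinates \<open>y\<close> of the side face \<open>s\<close>, each of the two
  planes is a single equation: one relates only \<open>y 2\<close> and \<open>y 3\<close>, the other
  only \<open>y 0\<close> and \<open>y 1\<close>. Their intersection is thus a line, and each cross
  point lies in the plane through its own edge anyway. What remains is that each lies in the other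
  plane, which is one equation for each of the two layer faces.\<close>

lemma cross_line_iff:
  assumes L: "lelieuvre_quad q m" "lelieuvre_quad q' m'" "lelieuvre_quad s l"
    and s: "s 0 = q 0" "s 1 = q 1" "s 2 = q' 1" "s 3 = q' 0"
    and l: "l 0 = m 0" "l 1 = m 1" "l 2 = m' 1" "l 3 = m' 0"
    and t: "t 0 = r 0" "t 1 = r 1" "t 2 = r' 1" "t 3 = r' 0"
    and r: "\<And>k. r k \<noteq> 0" "\<And>k. r' k \<noteq> 0"
  defines "X \<equiv> homog_quad q" and "X' \<equiv> homog_quad q'"
  shows "inc {cross_point X r 0, cross_point X' r' 0} =
      inc {X 0, X 1, cross_point X r 2} \<inter> inc {X' 0, X' 1, cross_point X' r' 2} \<longleftrightarrow>
    quad_ratio m r = quad_ratio l t \<and>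
    quad_ratio m' r' * quad_ratio l t = 1"
    (is "?lhs \<longleftrightarrow> ?rhs")
proof -
  define S where "S = homog_quad s"
  define g where "g = dual_form s l"
  define y where "y k w = g k w / g k (S k)" for k w
  define a a' b V V' W where abV: "a = quad_moutard m" "a' = quad_moutard m'" "b = quad_moutard l"
    "V = m 0 \<bullet> cross3 (m 1) (m 3)" "V' = m' 0 \<bullet> cross3 (m' 1) (m' 3)"
    "W = l 0 \<bullet> cross3 (l 1) (l 3)"
  note v = dual_form_values[OF L(1)] dual_form_values[OF L(2)] dual_form_values[OF L(3)]
  note v = v[folded abV]
  have nz: "a \<noteq> 0" "a' \<noteq> 0" "b \<noteq> 0" "V \<noteq> 0" "V' \<noteq> 0" "W \<noteq> 0"
    using L by (auto simp: abV dest: lelieuvre_quad_moutard)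
  have dS: "dual_quad S g" using v(15) by (simp add: S_def g_def)
  have lin: "linear (g k)" and dual: "g k (S j) \<noteq> 0 \<longleftrightarrow> k = j" for k j
    using dS by (auto simp: dual_quad_def)
  have exp: "w = y 0 w *\<^sub>R S 0 + y 1 w *\<^sub>R S 1 + y 2 w *\<^sub>R S 2 + y 3 w *\<^sub>R S 3" for w
    using dual_quad_expansion[OF dS, of w] by (simp add: sum_four y_def)
  have yadd: "y k (u + w) = y k u + y k w" and ymul: "y k (c *\<^sub>R w) = c * y k w" for k u w c
    by (simp_all add: y_def linear_add[OF lin] linear_cmul[OF lin] add_divide_distrib)
  have yS: "y k (S j) = (if k = j then 1 else 0)" for k j
    using dual[of k j] by (auto simp: y_def)
  have XS: "X 0 = S 0" "X 1 = S 1" "X' 1 = S 2" "X' 0 = S 3"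
    by (simp_all add: X_def X'_def S_def homog_quad_def s)
  have gv: "g 0 (S 0) = b * W" "g 1 (S 1) = - W" "g 2 (S 2) = - b * W" "g 3 (S 3) = W"
    using v by (simp_all add: S_def g_def homog_quad_def)
  \<comment> \<open>A dual form is the plane at the opposite vertex. Vertices shared with the side
    face carry the same normal, so the forms coincide under shifted indices.\<close>
  have fg: "dual_form q m 2 = g 2" "dual_form q m 3 = g 3" "dual_form q' m' 3 = g 0"
      "dual_form q' m' 2 = g 1"
    by (simp_all add: g_def dual_form_def s l)
  have gy: "g k w = y k w * g k (S k)" for k w
    using dual[of k k] by (simp add: y_def)
  have plane: "w \<in> inc {X 0, X 1, cross_point X r 2} \<longleftrightarrow> b * r 3 * y 2 w = a * r 2 * y 3 w" for w
  proof -
    have "w \<in> inc {X 0, X 1, cross_point X r 2} \<longleftrightarrow>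
        g 2 w * (r 3 * V) = g 3 w * (r 2 * (- a * V))"
      unfolding inc_def
      using span_cross_point_iff[OF v(5), of r w] r(1) v(3,4) fg
      by (simp add: X_def) (simp add: homog_quad_def)
    then show ?thesis
      unfolding gy[of 2 w] gy[of 3 w] gv using nz by (auto simp: field_simps)
  qed
  have plane': "w \<in> inc {X' 0, X' 1, cross_point X' r' 2} \<longleftrightarrow> r' 3 * y 1 w = a' * b * r' 2 * y 0 w" for w
  proof -
    have "w \<in> inc {X' 0, X' 1, cross_point X' r' 2} \<longleftrightarrow>
        g 1 w * (r' 3 * V') = g 0 w * (r' 2 * (- a' * V'))"
      unfolding inc_def
      using span_cross_point_iff[OF v(10), of r' w] r(2) v(8,9) fg
      by (simp add: X'_def) (simp add: homog_quad_def)
    then show ?thesis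
      unfolding gy[of 0 w] gy[of 1 w] gv using nz by (auto simp: field_simps)
  qed
  define p p' where "p = cross_point X r 0" and "p' = cross_point X' r' 0"
  have yp: "y 0 p = r 0" "y 1 p = r 1" "y 2 p = 0" "y 3 p = 0"
     "y 0 p' = 0" "y 1 p' = 0" "y 2 p' = r' 1" "y 3 p' = r' 0"
    by (simp_all add: p_def p'_def cross_point_def XS yadd ymul yS)
  have rhs: "?rhs \<longleftrightarrow> b * r 3 * r' 1 = a * r 2 * r' 0 \<and> r' 3 * r 1 = a' * b * r' 2 * r 0"
    using nz r unfolding quad_ratio_def t abV[symmetric] by (auto simp: field_simps)
  show ?thesis
  proof
    assume ?lhs
    then have "p \<in> inc {X' 0, X' 1, cross_point X' r' 2}" "p' \<in> inc {X 0, X 1, cross_point X r 2}"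
      unfolding p_def[symmetric] p'_def[symmetric] by (auto simp: inc_def intro: span_base)
    then show ?rhs unfolding plane plane' rhs yp by simp
  next
    assume ?rhs
    then have c: "b * r 3 * r' 1 = a * r 2 * r' 0" "r' 3 * r 1 = a' * b * r' 2 * r 0"
      using rhs by auto
    show ?lhs
      unfolding p_def[symmetric] p'_def[symmetric]
    proof (intro equalityI subsetI IntI)
      fix w assume "w \<in> inc {p, p'}"
      then obtain c d where "w - c *\<^sub>R p - d *\<^sub>R p' = 0"
        unfolding inc_def span_insert span_empty by auto
      then have w: "w = c *\<^sub>R p + d *\<^sub>R p'" by (simp add: algebra_simps)
      show "w \<in> inc {X 0, X 1, cross_point X r 2}" "w \<in> inc {X' 0, X' 1, cross_point X' r' 2}"
        unfolding plane plane' w yadd ymul yp using \<open>b * r 3 * r' 1 = _\<close> \<open>r' 3 * r 1 = _\<close> by simp_all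
    next
      fix w
      assume "w \<in> inc {X 0, X 1, cross_point X r 2} \<inter> inc {X' 0, X' 1, cross_point X' r' 2}"
      then have e: "b * r 3 * y 2 w = a * r 2 * y 3 w" "r' 3 * y 1 w = a' * b * r' 2 * y 0 w"
        using plane plane' by auto
      \<comment> \<open>Cancelling the nonzero factors shows that the coordinates of
        \<open>w\<close> on either edge are proportional to those of the cross point there, so
        \<open>w\<close> is a combination of \<open>p\<close> and \<open>p'\<close>.\<close>
      have "r' 3 * (y 1 w * r 0 - y 0 w * r 1) = r 0 * (r' 3 * y 1 w) - y 0 w * (r' 3 * r 1)"
        by (simp add: algebra_simps)
      also have "\<dots> = 0" unfolding e c by simp
      finally have 1: "r' 3 * (y 1 w * r 0 - y 0 w * r 1) = 0" .
      have "(b * r 3) * (y 2 w * r' 0 - y 3 w * r' 1) = r' 0 * (b * r 3 * y 2 w) - y 3 w * (b * r 3 * r' 1)"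
        by (simp add: algebra_simps)
      also have "\<dots> = 0" unfolding e c by simp
      finally have 2: "(b * r 3) * (y 2 w * r' 0 - y 3 w * r' 1) = 0" .
      have 3: "(y 0 w / r 0) * r 1 = y 1 w" "(y 3 w / r' 0) * r' 1 = y 2 w"
        using 1 2 nz r by (simp_all add: field_simps)
      have "(y 0 w / r 0) *\<^sub>R p = y 0 w *\<^sub>R S 0 + y 1 w *\<^sub>R S 1"
        using r 3(1) by (simp add: p_def cross_point_def XS scaleR_add_right)
      moreover have "(y 3 w / r' 0) *\<^sub>R p' = y 3 w *\<^sub>R S 3 + y 2 w *\<^sub>R S 2"
        using r 3(2) by (simp add: p'_def cross_point_def XS scaleR_add_right)
      ultimately have "w = (y 0 w / r 0) *\<^sub>R p + (y 3 w / r' 0) *\<^sub>R p'"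
        using exp[of w] by (simp add: add_ac)
      also have "\<dots> \<in> inc {p, p'}"
        unfolding inc_def by (intro span_add span_scale span_base) auto
      finally show "w \<in> inc {p, p'}" .
    qed
  qed
qed

subsection \<open>Hyperboloids and the $C^1$-condition\<close>

text \<open>
  In the basis \<open>r k *\<^sub>R X k\<close> this is, up to a scalar, the form
  \<open>y\<^sub>0 y\<^sub>2 - y\<^sub>1 y\<^sub>3\<close>: the edges kill all other coefficients, and the relative weight is
  forced by the two further lines through the cross.
\<close>

definition cross_form ::
  "(4 \<Rightarrow> hpoint) \<Rightarrow> (4 \<Rightarrow> hpoint \<Rightarrow> real) \<Rightarrow> (4 \<Rightarrow> real) \<Rightarrow> hpoint \<Rightarrow> hpoint \<Rightarrow> real" where
  "cross_form X f r u v =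
     (f 0 u * f 2 v + f 2 u * f 0 v) / (r 0 * r 2 * f 0 (X 0) * f 2 (X 2)) -
     (f 1 u * f 3 v + f 3 u * f 1 v) / (r 1 * r 3 * f 1 (X 1) * f 3 (X 3))"

lemma mem_inc2: "w \<in> inc {a, b} \<longleftrightarrow> (\<exists>s t. w = s *\<^sub>R a + t *\<^sub>R b)"
proof
  assume "w \<in> inc {a, b}"
  then obtain s t where "w - s *\<^sub>R a - t *\<^sub>R b = 0"
    unfolding inc_def span_insert span_empty by auto
  then have "w = s *\<^sub>R a + t *\<^sub>R b" by (simp add: algebra_simps)
  then show "\<exists>s t. w = s *\<^sub>R a + t *\<^sub>R b" by blast
next
  assume "\<exists>s t. w = s *\<^sub>R a + t *\<^sub>R b"
  then show "w \<in> inc {a, b}"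
    by (auto simp: inc_def) (simp add: span_add span_scale span_base)
qed

lemma cross_hyperboloid_cross_form:
  assumes dual: "dual_quad (homog_quad q) f" and r: "\<And>k. r k \<noteq> 0"
  defines "X \<equiv> homog_quad q"
  shows "cross_hyperboloid q (cross_point X r) (cross_form X f r)"
proof -
  have lin: "linear (f k)" and d: "f k (X j) \<noteq> 0 \<longleftrightarrow> k = j" for k j
    using dual by (auto simp: dual_quad_def X_def)
  have ez: "f k (X j) = 0" if "k \<noteq> j" for k j using d that by blast
  have nz: "f k (X k) \<noteq> 0" for k using d by blast
  note ls = linear_add[OF lin] linear_cmul[OF lin]
  have "bilinear (cross_form X f r)"
    unfolding bilinear_def cross_form_def
    by (intro conjI allI linearI)
       (simp_all add: ls add_divide_distrib diff_divide_distrib algebra_simps)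
  moreover have "cross_form X f r u v = cross_form X f r v u" for u v
    by (simp add: cross_form_def algebra_simps)
  moreover have "\<forall>u. (\<forall>v. cross_form X f r u v = 0) \<longrightarrow> u = 0"
  proof (intro allI impI)
    fix u assume u: "\<forall>v. cross_form X f r u v = 0"
    \<comment> \<open>Pairing with a vertex isolates the coordinate at the opposite vertex.\<close>
    have "f 2 u = 0" "f 3 u = 0" "f 0 u = 0" "f 1 u = 0"
      using u[rule_format, of "X 0"] u[rule_format, of "X 1"] u[rule_format, of "X 2"]
        u[rule_format, of "X 3"]
      by (simp_all add: cross_form_def ez nz r)
    then show "u = 0"
      using dual_quad_expansion[OF dual, of u] by (simp add: sum_four)
  qed
  moreover
  have edge: "inc {X k, X (k + 1)} \<subseteq> quadric (cross_form X f r)" for k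
  proof -
    have "\<forall>k. \<forall>s t. cross_form X f r (s *\<^sub>R X k + t *\<^sub>R X (k + 1)) (s *\<^sub>R X k + t *\<^sub>R X (k + 1)) = 0"
      unfolding all_four by (simp add: cross_form_def ls ez)
    then show ?thesis by (auto simp: mem_inc2 quadric_def)
  qed
  then have "\<forall>k. inc {homog (q k), homog (q (k + 1))} \<subseteq> quadric (cross_form X f r)"
    by (simp add: X_def homog_quad_def)
  moreover have "\<exists>L. subspace L \<and> dim L = 2 \<and> L \<subseteq> quadric (cross_form X f r)"
  proof (intro exI conjI)
    show "subspace (inc {X 0, X 1})" unfolding inc_def by (rule subspace_span)
    have "X 0 \<noteq> X 1" using ez[of 0 1] nz[of 0] by auto
    moreover have "independent {X 0, X 1}"
    proof -
      have "X 1 \<noteq> 0" using nz[of 1] linear_0[OF lin] by metis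
      moreover have "X 0 \<notin> span {X 1}"
        using nz[of 0] ez[of 0 1] by (auto simp: span_singleton ls)
      ultimately show ?thesis
        using \<open>X 0 \<noteq> X 1\<close> by (simp add: independent_insert)
    qed
    ultimately show "dim (inc {X 0, X 1}) = 2"
      unfolding inc_def dim_span by (simp add: dim_eq_card_independent)
    show "inc {X 0, X 1} \<subseteq> quadric (cross_form X f r)"
      using edge[of 0] by simp
  qed
  moreover have "inc {cross_point X r 0, cross_point X r 2} \<subseteq> quadric (cross_form X f r)"
    "inc {cross_point X r 1, cross_point X r 3} \<subseteq> quadric (cross_form X f r)"
    by (auto simp: mem_inc2 quadric_def cross_form_def cross_point_def ls ez nz r)
  ultimately show ?thesis
    unfolding cross_hyperboloid_def hyperboloid_def by blast
qed

lemma cross_hyperboloid_unique: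
  assumes B: "cross_hyperboloid q (cross_point (homog_quad q) r) B"
    and dual: "dual_quad (homog_quad q) f" and r: "\<And>k. r k \<noteq> 0"
  obtains c where "c \<noteq> 0" "\<And>u v. B u v = c * cross_form (homog_quad q) f r u v"
proof -
  define X where "X = homog_quad q"
  have bil: "bilinear B" and sym: "\<And>u v. B u v = B v u"
    and nondeg: "\<And>u. (\<forall>v. B u v = 0) \<Longrightarrow> u = 0"
    and edges: "\<And>k. inc {X k, X (k + 1)} \<subseteq> quadric B"
    and rulings: "inc {cross_point X r 0, cross_point X r 2} \<subseteq> quadric B"
    using B by (auto simp: cross_hyperboloid_def hyperboloid_def X_def homog_quad_def)
  note bs = bilinear_ladd[OF bil] bilinear_radd[OF bil] bilinear_lmul[OF bil] bilinear_rmul[OF bil]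
  have isotropic: "B a a = 0 \<and> B a b = 0 \<and> B b a = 0 \<and> B b b = 0"
    if "inc {a, b} \<subseteq> quadric B" for a b
  proof -
    have "a \<in> inc {a, b}" "b \<in> inc {a, b}" "a + b \<in> inc {a, b}"
      unfolding inc_def by (auto intro: span_base span_add)
    then have "B a a = 0" "B b b = 0" "B (a + b) (a + b) = 0"
      using that by (auto simp: quadric_def)
    then show ?thesis using sym[of a b] by (simp add: bs)
  qed
  have "\<forall>k. B (X k) (X k) = 0 \<and> B (X k) (X (k + 1)) = 0 \<and> B (X (k + 1)) (X k) = 0"
    using isotropic[OF edges] by blast
  then have z: "B (X 0) (X 0) = 0" "B (X 1) (X 1) = 0" "B (X 2) (X 2) = 0" "B (X 3) (X 3) = 0"
    "B (X 0) (X 1) = 0" "B (X 1) (X 2) = 0" "B (X 2) (X 3) = 0" "B (X 3) (X 0) = 0"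
    "B (X 1) (X 0) = 0" "B (X 2) (X 1) = 0" "B (X 3) (X 2) = 0" "B (X 0) (X 3) = 0"
    unfolding all_four by simp_all
  define \<beta> \<delta> where "\<beta> = B (X 0) (X 2)" and "\<delta> = B (X 1) (X 3)"
  have z2: "B (X 2) (X 0) = \<beta>" "B (X 3) (X 1) = \<delta>" "B (X 0) (X 2) = \<beta>" "B (X 1) (X 3) = \<delta>"
    using sym by (auto simp: \<beta>_def \<delta>_def)
  have "B (cross_point X r 0) (cross_point X r 2) = 0"
    using isotropic[OF rulings] by blast
  then have rel: "r 0 * r 2 * \<beta> + r 1 * r 3 * \<delta> = 0"
    by (simp add: cross_point_def bs z z2 mult_ac)
  define y where "y k w = f k w / f k (X k)" for k w
  have exp: "w = y 0 w *\<^sub>R X 0 + y 1 w *\<^sub>R X 1 + y 2 w *\<^sub>R X 2 + y 3 w *\<^sub>R X 3" for w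
    using dual_quad_expansion[OF dual, of w] by (simp add: sum_four y_def X_def)
  have Buv: "B u v = \<beta> * (y 0 u * y 2 v + y 2 u * y 0 v) + \<delta> * (y 1 u * y 3 v + y 3 u * y 1 v)" for u v
    by (subst exp[of u], subst exp[of v]) (simp add: bs z z2 algebra_simps)
  have \<delta>: "\<delta> = - (\<beta> * r 0 * r 2) / (r 1 * r 3)"
    using rel r by (simp add: field_simps)
  have fX: "f k (X k) \<noteq> 0" for k
    using dual by (auto simp: dual_quad_def X_def)
  have eq: "B u v = (\<beta> * r 0 * r 2) * cross_form X f r u v" for u v
    unfolding Buv \<delta> cross_form_def y_def using r fX[of 0] fX[of 1] fX[of 2] fX[of 3]
    by (simp add: field_simps)
  \<comment> \<open>With \<beta> the whole form \<open>B\<close> would vanish, against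
    nondegeneracy.\<close>
  have "\<beta> \<noteq> 0"
  proof
    assume "\<beta> = 0"
    then have "X 0 = 0" using nondeg[of "X 0"] eq by simp
    moreover have "linear (f 0)" using dual by (auto simp: dual_quad_def)
    ultimately show False using linear_0 fX[of 0] by metis
  qed
  then show thesis
    using that[of "\<beta> * r 0 * r 2"] eq r by (simp add: X_def)
qed

text \<open>At the point \<open>s *\<^sub>R X 3 + t *\<^sub>R X 2\<close> of the common edge, both
  tangent planes belong to the pencil spanned by the planes at its endpoints, the forms
  \<open>f 1\<close> and \<open>f 0\<close>. Their parameters in it are
  \<open>s : t / \<gamma>\<close> and \<open>s : t * \<gamma>'\<close>.\<close>

lemma C1_condition_iff:
  assumes L: "lelieuvre_quad q m" "lelieuvre_quad q' m'"
    and q': "q' 0 = q 3" "q' 1 = q 2" and m': "m' 0 = m 3" "m' 1 = m 2"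
    and r: "\<And>k. r k \<noteq> 0" "\<And>k. r' k \<noteq> 0"
  shows "C1_condition (q 3) (q 2) q (cross_point (homog_quad q) r) q' (cross_point (homog_quad q') r') \<longleftrightarrow>
    quad_ratio m r * quad_ratio m' r' = 1"
proof -
  define X X' f f' where "X = homog_quad q" "X' = homog_quad q'" "f = dual_form q m" "f' = dual_form q' m'"
  note X = this
  define a a' V V' where abV: "a = quad_moutard m" "a' = quad_moutard m'"
    "V = m 0 \<bullet> cross3 (m 1) (m 3)" "V' = m' 0 \<bullet> cross3 (m' 1) (m' 3)"
  define \<gamma> \<gamma>' where \<gamma>: "\<gamma> = quad_ratio m r" "\<gamma>' = quad_ratio m' r'"
  have nz: "a \<noteq> 0" "a' \<noteq> 0" "V \<noteq> 0" "V' \<noteq> 0"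
    using L by (auto simp: abV dest: lelieuvre_quad_moutard)
  then have \<gamma>nz: "\<gamma> \<noteq> 0" "\<gamma>' \<noteq> 0"
    using r by (simp_all add: \<gamma> quad_ratio_def abV)
  have v: "f 0 (X 0) = a * V" "f 1 (X 1) = - V" "f 2 (X 2) = - a * V" "f 3 (X 3) = V" "dual_quad X f"
    "f' 0 (X' 0) = a' * V'" "f' 1 (X' 1) = - V'" "f' 2 (X' 2) = - a' * V'" "f' 3 (X' 3) = V'"
    "dual_quad X' f'"
    using dual_form_values[OF L(1)] dual_form_values[OF L(2)] by (simp_all add: X abV) (simp_all add: homog_quad_def)
  have lin: "linear (f k)" "linear (f' k)"
    and d: "k \<noteq> j \<Longrightarrow> f k (X j) = 0" "k \<noteq> j \<Longrightarrow> f' k (X' j) = 0" for k j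
    using v(5,10) by (auto simp: dual_quad_def)
  note ls = linear_add[OF lin(1)] linear_cmul[OF lin(1)] linear_add[OF lin(2)] linear_cmul[OF lin(2)]
  have XX: "X 3 = X' 0" "X 2 = X' 1"
    by (simp_all add: X homog_quad_def q')
  have ff: "f' 2 = f 1" "f' 3 = f 0"
    by (simp_all add: X dual_form_def q' m')
  define Q where "Q = cross_form X f r"
  define Q' where "Q' = cross_form X' f' r'"
  have Q: "Q (s *\<^sub>R X 3 + t *\<^sub>R X 2) w = (s * f 1 w + t * f 0 w / \<gamma>) / (r 1 * r 3 * V)" for s t w
    unfolding Q_def cross_form_def \<gamma> quad_ratio_def abV(1)[symmetric]
    using nz r by (simp add: ls d v field_simps)
  have Q': "Q' (s *\<^sub>R X' 0 + t *\<^sub>R X' 1) w = - (s * f 1 w + t * f 0 w * \<gamma>') / (r' 0 * r' 2 * a' * V')" for s t w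
    unfolding Q'_def cross_form_def \<gamma> quad_ratio_def abV(2)[symmetric] ff[symmetric]
    using nz r by (simp add: ls d v field_simps)
  have Q0: "w \<in> tangent_plane Q (s *\<^sub>R X 3 + t *\<^sub>R X 2) \<longleftrightarrow> s * f 1 w + t * f 0 w / \<gamma> = 0"
    and Q'0: "w \<in> tangent_plane Q' (s *\<^sub>R X 3 + t *\<^sub>R X 2) \<longleftrightarrow> s * f 1 w + t * f 0 w * \<gamma>' = 0" for s t w
    unfolding tangent_plane_def using nz r by (simp_all add: Q Q'[folded XX] neg_eq_iff_add_eq_0)
  \<comment> \<open>Hyperboloid forms are unique up to a nonzero factor, which tangent planes do not
    see, so the two explicit forms may replace the quantified ones.\<close>
  have C1: "C1_condition (q 3) (q 2) q (cross_point X r) q' (cross_point X' r') \<longleftrightarrow>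
    (\<forall>v\<in>inc {X 3, X 2}. v \<noteq> 0 \<longrightarrow> tangent_plane Q v = tangent_plane Q' v)"
  proof
    assume "C1_condition (q 3) (q 2) q (cross_point X r) q' (cross_point X' r')"
    then obtain B B' where B: "cross_hyperboloid q (cross_point X r) B"
        "cross_hyperboloid q' (cross_point X' r') B'"
        "\<And>v. v \<in> inc {X 3, X 2} \<Longrightarrow> v \<noteq> 0 \<Longrightarrow> tangent_plane B v = tangent_plane B' v"
      unfolding C1_condition_def X homog_quad_def by blast
    obtain c where c: "c \<noteq> 0" "\<And>u v. B u v = c * Q u v"
      using cross_hyperboloid_unique[OF B(1)[unfolded X] v(5)[unfolded X] r(1)] unfolding Q_def X by blast
    obtain c' where c': "c' \<noteq> 0" "\<And>u v. B' u v = c' * Q' u v"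
      using cross_hyperboloid_unique[OF B(2)[unfolded X] v(10)[unfolded X] r(2)] unfolding Q'_def X by blast
    have "tangent_plane B v = tangent_plane Q v" "tangent_plane B' v = tangent_plane Q' v" for v
      using c c' by (simp_all add: tangent_plane_def)
    with B(3) show "\<forall>v\<in>inc {X 3, X 2}. v \<noteq> 0 \<longrightarrow> tangent_plane Q v = tangent_plane Q' v"
      by simp
  next
    assume "\<forall>v\<in>inc {X 3, X 2}. v \<noteq> 0 \<longrightarrow> tangent_plane Q v = tangent_plane Q' v"
    moreover have "cross_hyperboloid q (cross_point X r) Q"
      using cross_hyperboloid_cross_form[OF v(5)[unfolded X], of r] r(1) unfolding Q_def X by blast
    moreover have "cross_hyperboloid q' (cross_point X' r') Q'"
      using cross_hyperboloid_cross_form[OF v(10)[unfolded X], of r'] r(2) unfolding Q'_def X by blast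
    ultimately show "C1_condition (q 3) (q 2) q (cross_point X r) q' (cross_point X' r')"
      unfolding C1_condition_def X homog_quad_def by blast
  qed
  have "(\<forall>v\<in>inc {X 3, X 2}. v \<noteq> 0 \<longrightarrow> tangent_plane Q v = tangent_plane Q' v) \<longleftrightarrow> \<gamma> * \<gamma>' = 1"
  proof
    assume "\<gamma> * \<gamma>' = 1"
    then have "\<gamma>' = 1 / \<gamma>" using \<gamma>nz by (simp add: field_simps)
    then show "\<forall>v\<in>inc {X 3, X 2}. v \<noteq> 0 \<longrightarrow> tangent_plane Q v = tangent_plane Q' v"
      using Q0 Q'0 by (auto simp: mem_inc2)
  next
    assume all: "\<forall>v\<in>inc {X 3, X 2}. v \<noteq> 0 \<longrightarrow> tangent_plane Q v = tangent_plane Q' v"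
    have "1 *\<^sub>R X 3 + 1 *\<^sub>R X 2 \<in> inc {X 3, X 2}" by (auto simp only: mem_inc2)
    moreover have "f 2 (1 *\<^sub>R X 3 + 1 *\<^sub>R X 2) \<noteq> 0" using nz by (simp add: ls d v)
    then have "1 *\<^sub>R X 3 + 1 *\<^sub>R X 2 \<noteq> 0" using linear_0[OF lin(1)] by metis
    ultimately have eq: "tangent_plane Q (1 *\<^sub>R X 3 + 1 *\<^sub>R X 2) = tangent_plane Q' (1 *\<^sub>R X 3 + 1 *\<^sub>R X 2)"
      using all by blast
    \<comment> \<open>A point of the tangent plane of \<open>Q\<close> at \<open>X 3 + X 2\<close>,
      normalized by \<open>f 0 w = 1\<close>; the equation of the other tangent plane then reads off
      \<open>\<gamma>'\<close>.\<close>
    define w where "w = (1 / (a * V)) *\<^sub>R X 0 + (1 / (\<gamma> * V)) *\<^sub>R X 1"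
    have w: "f 0 w = 1" "f 1 w = - 1 / \<gamma>"
      using nz by (simp_all add: w_def ls d v)
    have "w \<in> tangent_plane Q (1 *\<^sub>R X 3 + 1 *\<^sub>R X 2)"
      unfolding Q0 by (simp add: w)
    then have "- 1 / \<gamma> + \<gamma>' = 0"
      unfolding eq Q'0 by (simp add: w)
    then show "\<gamma> * \<gamma>' = 1" using \<gamma>nz by (simp add: field_simps)
  qed
  with C1 show ?thesis by (simp add: X \<gamma>)
qed

subsection \<open>Nets on two layers\<close>

lemma dir_nth: "dir i $ k = (if k = i then 1 else 0)"
  by (simp add: dir_def axis_def)

lemma corner_simps [simp]:
  "corner z i j 0 = z" "corner z i j 1 = z + dir i" "corner z i j 2 = z + dir i + dir j"
  "corner z i j 3 = z + dir j"
  by (simp_all add: corner_def)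

lemma elementary_quad_two_layers:
  "elementary_quad two_layers z i j \<longleftrightarrow>
    i \<noteq> j \<and> z \<in> two_layers \<and> (i = 3 \<or> j = 3 \<longrightarrow> z \<in> layer 0)"
  by (auto simp: elementary_quad_def range_four two_layers_def layer_def dir_nth)

lemma elementary_quad_layer:
  "elementary_quad (layer k) z i j \<longleftrightarrow> z \<in> layer k \<and> (i, j) \<in> {(1, 2), (2, 1)}"
  using exhaust_3[of i] exhaust_3[of j]
  by (auto simp: elementary_quad_def range_four layer_def dir_nth)

lemma layer_subset_two_layers: "k \<in> {0, 1} \<Longrightarrow> layer k \<subseteq> two_layers"
  by (auto simp: layer_def two_layers_def)

lemma quad_cross_eq:
  "quad_cross x \<rho> z i j = cross_point (homog_quad (x \<circ> corner z i j)) (\<rho> \<circ> corner z i j)"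
  by (rule ext) (simp add: quad_cross_def cross_vertex_def cross_point_def homog_quad_def homog_def)

lemma moutard_coeff_eq: "moutard_coeff n i j z = quad_moutard (n \<circ> corner z i j)"
  by (simp add: moutard_coeff_def quad_moutard_def)

lemma lelieuvre_quad_corner:
  assumes "lelieuvre_normal_field D x n" "elementary_quad D z i j" "A_net D x"
  shows "lelieuvre_quad (x \<circ> corner z i j) (n \<circ> corner z i j)"
proof -
  have D: "z \<in> D" "z + dir i \<in> D" "z + dir i + dir j \<in> D" "z + dir j \<in> D"
    using assms(2) by (auto simp: elementary_quad_def range_four)
  have n: "x (w + dir i) - x w = cross3 (n (w + dir i)) (n w)" if "w \<in> D" "w + dir i \<in> D" for w i
    using assms(1) that by (simp add: lelieuvre_normal_field_def)
  have n': "x w - x (w + dir i) = cross3 (n w) (n (w + dir i))" if "w \<in> D" "w + dir i \<in> D" for w i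
    using n[OF that] by (metis cross_skew minus_diff_eq)
  have eq: "z + dir j + dir i = z + dir i + dir j" by (simp add: add_ac)
  have "x (z + dir j) - x (z + dir i + dir j) = cross3 (n (z + dir j)) (n (z + dir i + dir j))"
    using n'[of "z + dir j" i] D unfolding eq by simp
  then show ?thesis
    using assms(2,3) n[of z i] n[of "z + dir i" j] n'[of z j] D
    by (simp add: lelieuvre_quad_def A_net_def all_four)
qed

definition moutard_ratio :: "(int^3 \<Rightarrow> real^3) \<Rightarrow> (int^3 \<Rightarrow> real) \<Rightarrow> 3 \<Rightarrow> 3 \<Rightarrow> int^3 \<Rightarrow> real" where
  "moutard_ratio n \<rho> i j z = quad_ratio (n \<circ> corner z i j) (\<rho> \<circ> corner z i j)"

lemma corner_swap: "corner z j i k = corner z i j (- k)"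
proof -
  have neg3: "- (3::4) = 1" by simp
  have "\<forall>k. corner z j i k = corner z i j (- k)"
    unfolding all_four by (simp add: add_ac neg3)
  then show ?thesis by blast
qed

text \<open>Exchanging the directions maps corner \<open>k\<close> to
  \<open>- k = 1 - (k + 1)\<close>, a reflection combined with a rotation. Their effects, inversion
  and negative inversion, compose to a change of sign.\<close>

lemma moutard_ratio_swap:
  assumes "lelieuvre_quad (x \<circ> corner z i j) (n \<circ> corner z i j)" "\<And>k. \<rho> (corner z i j k) \<noteq> 0"
  shows "moutard_ratio n \<rho> j i z = - moutard_ratio n \<rho> i j z"
proof -
  have "quad_ratio (\<lambda>k. (n \<circ> corner z i j) (1 - (k + 1))) (\<lambda>k. (\<rho> \<circ> corner z i j) (1 - (k + 1)))
      = - 1 / quad_ratio (\<lambda>k. (n \<circ> corner z i j) (1 - k)) (\<lambda>k. (\<rho> \<circ> corner z i j) (1 - k))"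
    by (rule quad_ratio_shift[OF lelieuvre_quad_reflect[OF assms(1)]]) (use assms(2) in simp)
  also have "\<dots> = - moutard_ratio n \<rho> i j z"
    using quad_ratio_reflect[OF assms(1), of "\<rho> \<circ> corner z i j"] assms(2)
    by (simp add: moutard_ratio_def comp_def)
  finally show ?thesis
    by (simp add: moutard_ratio_def comp_def corner_swap[of z j i])
qed

lemma parametrizes_moutard_iff:
  assumes "\<forall>z\<in>D. \<rho> z \<noteq> 0"
  shows "parametrizes_moutard D \<rho> n I \<longleftrightarrow>
    (\<forall>(i, j)\<in>I. \<forall>z. elementary_quad D z i j \<longrightarrow> moutard_ratio n \<rho> i j z = 1)"
proof -
  have "moutard_coeff n i j z = \<rho> (z + dir i) * \<rho> (z + dir j) / (\<rho> z * \<rho> (z + dir i + dir j)) \<longleftrightarrow>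
      moutard_ratio n \<rho> i j z = 1" if "elementary_quad D z i j" for i j z
  proof -
    have "z \<in> D" "z + dir i \<in> D" "z + dir i + dir j \<in> D" "z + dir j \<in> D"
      using that by (auto simp: elementary_quad_def range_four)
    with assms have "\<rho> z \<noteq> 0" "\<rho> (z + dir i) \<noteq> 0" "\<rho> (z + dir i + dir j) \<noteq> 0" "\<rho> (z + dir j) \<noteq> 0"
      by auto
    then show ?thesis
      unfolding moutard_ratio_def quad_ratio_def moutard_coeff_eq[symmetric] by (auto simp: field_simps)
  qed
  then show ?thesis unfolding parametrizes_moutard_def by blast
qed

lemma pre_hyperbolic_net_iff:
  assumes x: "crisscrossed_A_net two_layers x \<rho>" and n: "lelieuvre_normal_field two_layers x n"
    and k: "k \<in> {0, 1}"
  shows "pre_hyperbolic_net k x \<rho> \<longleftrightarrow> (\<forall>z\<in>layer k.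
    moutard_ratio n \<rho> 1 2 z * moutard_ratio n \<rho> 1 2 (z + dir 1) = 1 \<and>
    moutard_ratio n \<rho> 1 2 z * moutard_ratio n \<rho> 1 2 (z + dir 2) = 1)"
proof -
  have A: "A_net two_layers x" and \<rho>: "\<And>z. z \<in> two_layers \<Longrightarrow> \<rho> z \<noteq> 0"
    using x by (auto simp: crisscrossed_A_net_def)
  have sub: "layer k \<subseteq> two_layers" using layer_subset_two_layers[OF k] .
  have quads: "elementary_quad two_layers z i j" if "elementary_quad (layer k) z i j" for z i j
    using that sub by (auto simp: elementary_quad_def)
  \<comment> \<open>Stars get smaller when restricted to a layer. That they still span planes is the
    within-layer clause of the genericity assumption.\<close>
  have net: "crisscrossed_A_net (layer k) x \<rho>"
    unfolding crisscrossed_A_net_def A_net_def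
  proof (intro conjI ballI allI impI)
    fix z assume z: "z \<in> layer k"
    then have z2: "z \<in> two_layers" using sub by auto
    have "two_layers \<inter> layer (z $ 3) = layer k" "layer k \<inter> layer (z $ 3) = layer k"
      using z sub by (auto simp: layer_def)
    then show "aff_dim (vertex_star (layer k) x z) = 2"
        "aff_dim (vertex_star (layer k \<inter> layer (z $ 3)) x z) = 2"
      using A z2 unfolding A_net_def by metis+
    have "vertex_star (layer k) x z \<subseteq> vertex_star two_layers x z"
      using sub unfolding vertex_star_def by (intro image_mono) auto
    then show "coplanar (vertex_star (layer k) x z)"
      using A z2 coplanar_subset unfolding A_net_def by blast
    show "\<rho> z \<noteq> 0" using \<rho> z2 by simp
  next
    fix z i j assume "elementary_quad (layer k) z i j"
    from quads[OF this] show "skew_quad (x \<circ> corner z i j)"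
        "adapted_cross (x \<circ> corner z i j) (quad_cross x \<rho> z i j)"
      using x by (auto simp: crisscrossed_A_net_def A_net_def)
  qed
  have C1: "C1_condition (x (z + dir j)) (x (z + dir i + dir j))
          (x \<circ> corner z i j) (quad_cross x \<rho> z i j)
          (x \<circ> corner (z + dir j) i j) (quad_cross x \<rho> (z + dir j) i j) \<longleftrightarrow>
        moutard_ratio n \<rho> 1 2 z * moutard_ratio n \<rho> 1 2 (z + dir j) = 1"
    if "z \<in> layer k" "(i, j) \<in> {(1, 2), (2, 1)}" for z i j
  proof -
    have zj: "z + dir j \<in> layer k"
      using that by (auto simp: layer_def dir_nth)
    have q: "elementary_quad two_layers w i' j'" if "w \<in> {z, z + dir j}" "(i', j') \<in> {(1, 2), (2, 1)}" for w i' j'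
      using that \<open>z \<in> layer k\<close> zj by (intro quads) (auto simp: elementary_quad_layer)
    have r: "\<rho> (corner w i' j' k) \<noteq> 0" if "w \<in> {z, z + dir j}" "(i', j') \<in> {(1, 2), (2, 1)}" for w i' j' k
      using q[OF that] \<rho> by (auto simp: elementary_quad_def)
    note L = lelieuvre_quad_corner[OF n q A]
    have "C1_condition (x (z + dir j)) (x (z + dir i + dir j))
          (x \<circ> corner z i j) (quad_cross x \<rho> z i j)
          (x \<circ> corner (z + dir j) i j) (quad_cross x \<rho> (z + dir j) i j) \<longleftrightarrow>
        moutard_ratio n \<rho> i j z * moutard_ratio n \<rho> i j (z + dir j) = 1"
      unfolding quad_cross_eq moutard_ratio_def
      using C1_condition_iff[OF L[of z i j] L[of "z + dir j" i j], of "\<rho> \<circ> corner z i j" "\<rho> \<circ> corner (z + dir j) i j"] r that(2)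
      by (simp add: add_ac)
    \<comment> \<open>Edges of the other direction involve the ratios for (2,1); the two signs
      cancel in the product.\<close>
    moreover have "moutard_ratio n \<rho> 2 1 w = - moutard_ratio n \<rho> 1 2 w" if "w \<in> {z, z + dir j}" for w
      using moutard_ratio_swap[OF L[of w 1 2]] r[of w] that by simp
    ultimately show ?thesis
      using that(2) by auto
  qed
  have "z + dir 1 \<in> layer k" "z + dir 2 \<in> layer k" if "z \<in> layer k" for z
    using that by (auto simp: layer_def dir_nth)
  then have "pre_hyperbolic_net k x \<rho> \<longleftrightarrow> (\<forall>z\<in>layer k. \<forall>(i, j)\<in>{(1, 2), (2, 1)}.
      C1_condition (x (z + dir j)) (x (z + dir i + dir j))
          (x \<circ> corner z i j) (quad_cross x \<rho> z i j)
          (x \<circ> corner (z + dir j) i j) (quad_cross x \<rho> (z + dir j) i j))"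
    using net unfolding pre_hyperbolic_net_def elementary_quad_layer by auto
  also have "\<dots> \<longleftrightarrow> (\<forall>z\<in>layer k. \<forall>(i, j)\<in>{(1, 2), (2, 1)}.
      moutard_ratio n \<rho> 1 2 z * moutard_ratio n \<rho> 1 2 (z + dir j) = 1)"
    using C1 by (intro ball_cong refl) blast
  finally show ?thesis by auto
qed

section \<open>The faces and edge conditions of a Weingarten cube\<close>

definition side_quad :: "(4 \<Rightarrow> 'a) \<Rightarrow> (4 \<Rightarrow> 'a) \<Rightarrow> 4 \<Rightarrow> 4 \<Rightarrow> 'a" where
  "side_quad v v' i k = (if k = 0 then v i else if k = 1 then v (i + 1)
     else if k = 2 then v' (i + 1) else v' i)"

text \<open>Both layer faces are rotated so that edge \<open>i\<close> becomes edge 0;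
  \<open>side_quad\<close> is already numbered from that edge.\<close>

lemma cross_line_iff_side:
  assumes L: "lelieuvre_quad q m" "lelieuvre_quad q' m'"
    "lelieuvre_quad (side_quad q q' i) (side_quad m m' i)"
    and r: "\<And>k. r k \<noteq> 0" "\<And>k. r' k \<noteq> 0"
  defines "X \<equiv> homog_quad q" and "X' \<equiv> homog_quad q'"
  shows "inc {cross_point X r i, cross_point X' r' i} =
      inc {X i, X (i + 1), cross_point X r (i + 2)} \<inter> inc {X' i, X' (i + 1), cross_point X' r' (i + 2)} \<longleftrightarrow>
    quad_ratio (\<lambda>k. m (k + i)) (\<lambda>k. r (k + i)) = quad_ratio (side_quad m m' i) (side_quad r r' i) \<and>
    quad_ratio (\<lambda>k. m' (k + i)) (\<lambda>k. r' (k + i)) * quad_ratio (side_quad m m' i) (side_quad r r' i) = 1"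
proof -
  note iff = cross_line_iff[OF lelieuvre_quad_shift[OF L(1), of i] lelieuvre_quad_shift[OF L(2), of i] L(3),
      where r = "\<lambda>k. r (k + i)" and r' = "\<lambda>k. r' (k + i)" and t = "side_quad r r' i"]
  show ?thesis
    using iff r
    by (simp add: side_quad_def X_def X'_def cross_point_def homog_quad_def add_ac)
qed

definition neighbours :: "int^3 \<Rightarrow> (int^3) set" where
  "neighbours z = (\<Union>i. {z + dir i, z - dir i})"

lemma neighbours_sym: "w \<in> neighbours z \<longleftrightarrow> z \<in> neighbours w"
  by (auto simp: neighbours_def)

lemma neighbours_add_dir: "z + dir i \<in> neighbours z"
  by (auto simp: neighbours_def)

lemma corner_in_neighbours: "corner z i j (k + 1) \<in> neighbours (corner z i j k)"
proof -
  have eq: "z + dir j + dir i = z + dir i + dir j" by (simp add: add_ac)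
  have "z + dir j \<in> neighbours (z + dir i + dir j)"
    using neighbours_add_dir[of "z + dir j" i] unfolding eq by (metis neighbours_sym)
  moreover have "z \<in> neighbours (z + dir j)"
    using neighbours_sym neighbours_add_dir by blast
  ultimately have "\<forall>k. corner z i j (k + 1) \<in> neighbours (corner z i j k)"
    unfolding all_four using neighbours_add_dir by simp
  then show ?thesis by blast
qed

lemma coplanar_star:
  assumes "A_net D x" "z \<in> D" "S \<subseteq> D" "S \<subseteq> insert z (neighbours z)"
  shows "coplanar (x ` S)"
proof -
  have "x ` S \<subseteq> vertex_star D x z"
    using assms(3,4) unfolding vertex_star_def neighbours_def by (intro image_mono) auto
  then show ?thesis
    using assms(1,2) coplanar_subset unfolding A_net_def by blast
qed

lemma quad_ratio_shift_2_3:
  assumes "lelieuvre_quad q m" "\<And>k. r k \<noteq> 0"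
  shows "quad_ratio (\<lambda>k. m (k + 2)) (\<lambda>k. r (k + 2)) = quad_ratio m r"
    "quad_ratio (\<lambda>k. m (k + 3)) (\<lambda>k. r (k + 3)) = - 1 / quad_ratio m r"
proof -
  have 1: "quad_ratio (\<lambda>k. m (k + (c + 1))) (\<lambda>k. r (k + (c + 1)))
      = - 1 / quad_ratio (\<lambda>k. m (k + c)) (\<lambda>k. r (k + c))" for c
    using quad_ratio_shift[OF lelieuvre_quad_shift[OF assms(1), of c], of "\<lambda>k. r (k + c)"] assms(2)
    by (simp add: add_ac)
  show 2: "quad_ratio (\<lambda>k. m (k + 2)) (\<lambda>k. r (k + 2)) = quad_ratio m r"
    using 1[of 1] 1[of 0] by simp
  show "quad_ratio (\<lambda>k. m (k + 3)) (\<lambda>k. r (k + 3)) = - 1 / quad_ratio m r"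
    using 1[of 2] 2 by simp
qed

lemma side_quad_comp: "side_quad (f \<circ> v) (f \<circ> v') i = f \<circ> side_quad v v' i"
  by (rule ext) (simp add: side_quad_def)

text \<open>Going round the layer face, edges 2 and 3 run against the lattice directions, so the
  side faces over them appear reflected.\<close>

lemma side_quad_corner:
  fixes z :: "int^3"
  defines "v \<equiv> corner z 1 2" and "v' \<equiv> corner (z + dir 3) 1 2"
  shows "side_quad v v' 0 = corner z 1 3" "side_quad v v' 1 = corner (z + dir 1) 2 3"
    "side_quad v v' 2 = (\<lambda>k. corner (z + dir 2) 1 3 (1 - k))"
    "side_quad v v' 3 = (\<lambda>k. corner z 2 3 (1 - k))"
  unfolding fun_eq_iff all_four by (simp_all add: side_quad_def v_def v'_def add_ac)

text \<open>The skewness, star and cross clauses follow from the crisscrossed A-net, which leaves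
  two equations for each of the four edges. The negative inverses come from rotating an odd edge to
  position 0, the inverses of side ratios from the reflected sides 2 and 3.\<close>

lemma weingarten_cube_iff:
  assumes x: "crisscrossed_A_net two_layers x \<rho>" and n: "lelieuvre_normal_field two_layers x n"
    and z: "z \<in> layer 0"
  shows "weingarten_cube (x \<circ> corner z 1 2) (quad_cross x \<rho> z 1 2)
        (x \<circ> corner (z + dir 3) 1 2) (quad_cross x \<rho> (z + dir 3) 1 2) \<longleftrightarrow>
    moutard_ratio n \<rho> 1 2 z = moutard_ratio n \<rho> 1 3 z \<and>
    moutard_ratio n \<rho> 1 2 (z + dir 3) * moutard_ratio n \<rho> 1 3 z = 1 \<and>
    - 1 / moutard_ratio n \<rho> 1 2 z = moutard_ratio n \<rho> 2 3 (z + dir 1) \<and>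
    - 1 / moutard_ratio n \<rho> 1 2 (z + dir 3) * moutard_ratio n \<rho> 2 3 (z + dir 1) = 1 \<and>
    moutard_ratio n \<rho> 1 2 z = 1 / moutard_ratio n \<rho> 1 3 (z + dir 2) \<and>
    moutard_ratio n \<rho> 1 2 (z + dir 3) * (1 / moutard_ratio n \<rho> 1 3 (z + dir 2)) = 1 \<and>
    - 1 / moutard_ratio n \<rho> 1 2 z = 1 / moutard_ratio n \<rho> 2 3 z \<and>
    - 1 / moutard_ratio n \<rho> 1 2 (z + dir 3) * (1 / moutard_ratio n \<rho> 2 3 z) = 1"
proof -
  have A: "A_net two_layers x" and \<rho>: "\<And>z. z \<in> two_layers \<Longrightarrow> \<rho> z \<noteq> 0"
    using x by (auto simp: crisscrossed_A_net_def)
  define v where "v = corner z 1 2"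
  define v' where "v' = corner (z + dir 3) 1 2"
  define s where "s = side_quad v v'"
  have quads: "elementary_quad two_layers z 1 2" "elementary_quad two_layers (z + dir 3) 1 2"
    "elementary_quad two_layers z 1 3" "elementary_quad two_layers (z + dir 1) 2 3"
    "elementary_quad two_layers (z + dir 2) 1 3" "elementary_quad two_layers z 2 3"
    using z unfolding elementary_quad_two_layers by (auto simp: two_layers_def layer_def dir_nth)
  note L = quads[THEN lelieuvre_quad_corner[OF n _ A]]
  have r: "\<rho> (corner w i j k) \<noteq> 0" if "elementary_quad two_layers w i j" for w i j k
    using that \<rho> by (auto simp: elementary_quad_def)
  note r = quads[THEN r]
  have v2: "v i \<in> two_layers" "v' i \<in> two_layers" for i
    using quads(1,2) by (auto simp: elementary_quad_def v_def v'_def)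
  have sides: "s 0 = corner z 1 3" "s 1 = corner (z + dir 1) 2 3"
    "s 2 = (\<lambda>k. corner (z + dir 2) 1 3 (1 - k))" "s 3 = (\<lambda>k. corner z 2 3 (1 - k))"
    using side_quad_corner[of z] by (simp_all add: s_def v_def v'_def)
  have Lv: "lelieuvre_quad (x \<circ> v) (n \<circ> v)" "lelieuvre_quad (x \<circ> v') (n \<circ> v')"
    using L(1,2) by (simp_all add: v_def v'_def)
  have Ls: "lelieuvre_quad (x \<circ> s i) (n \<circ> s i)" for i
  proof -
    have "\<forall>i. lelieuvre_quad (x \<circ> s i) (n \<circ> s i)"
      unfolding all_four sides
      using L(3,4) lelieuvre_quad_reflect[OF L(5)] lelieuvre_quad_reflect[OF L(6)]
      by (simp add: comp_def)
    then show ?thesis by blast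
  qed
  have Ls': "lelieuvre_quad (side_quad (x \<circ> v) (x \<circ> v') i) (side_quad (n \<circ> v) (n \<circ> v') i)" for i
    using Ls by (simp add: side_quad_comp s_def)
  have side_skew: "\<not> coplanar {(x \<circ> v) i, (x \<circ> v) (i + 1), (x \<circ> v') (i + 1), (x \<circ> v') i}" for i
  proof -
    have "range (side_quad (x \<circ> v) (x \<circ> v') i)
        = {(x \<circ> v) i, (x \<circ> v) (i + 1), (x \<circ> v') (i + 1), (x \<circ> v') i}"
      unfolding range_four by (simp add: side_quad_def)
    then show ?thesis
      using Ls'[of i] by (metis lelieuvre_quad_def skew_quad_def)
  qed
  have v'v: "v' i = v i + dir 3" for i
  proof -
    have "\<forall>i. v' i = v i + dir 3"
      unfolding all_four by (simp add: v_def v'_def add_ac)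
    then show ?thesis by blast
  qed
  have next1: "v (i + 1) \<in> neighbours (v i)" "v' (i + 1) \<in> neighbours (v' i)" for i
    by (simp_all add: v_def v'_def corner_in_neighbours)
  have prev1: "v (i - 1) \<in> neighbours (v i)" "v' (i - 1) \<in> neighbours (v' i)" for i
    using next1[of "i - 1"] neighbours_sym by (metis diff_add_cancel)+
  have vert: "v' i \<in> neighbours (v i)" "v i \<in> neighbours (v' i)" for i
    using neighbours_add_dir neighbours_sym unfolding v'v by blast+
  have stars: "coplanar {(x \<circ> v) i, (x \<circ> v) (i - 1), (x \<circ> v) (i + 1), (x \<circ> v') i}"
      "coplanar {(x \<circ> v') i, (x \<circ> v') (i - 1), (x \<circ> v') (i + 1), (x \<circ> v) i}" for i
    using coplanar_star[OF A v2(1)[of i], of "{v i, v (i - 1), v (i + 1), v' i}"]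
      coplanar_star[OF A v2(2)[of i], of "{v' i, v' (i - 1), v' (i + 1), v i}"]
      next1 prev1 vert v2 by simp_all
  have skews: "skew_quad (x \<circ> v)" "skew_quad (x \<circ> v')"
    using Lv by (auto simp: lelieuvre_quad_def)
  have crosses: "adapted_cross (x \<circ> v) (quad_cross x \<rho> z 1 2)"
      "adapted_cross (x \<circ> v') (quad_cross x \<rho> (z + dir 3) 1 2)"
    using x quads by (auto simp: crisscrossed_A_net_def v_def v'_def)
  have "weingarten_cube (x \<circ> v) (quad_cross x \<rho> z 1 2) (x \<circ> v') (quad_cross x \<rho> (z + dir 3) 1 2) \<longleftrightarrow>
    (\<forall>i. quad_ratio (\<lambda>k. n (v (k + i))) (\<lambda>k. \<rho> (v (k + i))) = quad_ratio (n \<circ> s i) (\<rho> \<circ> s i) \<and>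
      quad_ratio (\<lambda>k. n (v' (k + i))) (\<lambda>k. \<rho> (v' (k + i))) * quad_ratio (n \<circ> s i) (\<rho> \<circ> s i) = 1)"
    unfolding weingarten_cube_def quad_cross_eq v_def[symmetric] v'_def[symmetric]
    using cross_line_iff_side[OF Lv Ls', of "\<rho> \<circ> v" "\<rho> \<circ> v'"] r(1,2) skews side_skew stars
      crosses[unfolded quad_cross_eq, folded v_def v'_def]
    by (simp add: side_quad_comp homog_quad_def v_def[symmetric] v'_def[symmetric] s_def[symmetric])
  also have "\<dots> \<longleftrightarrow> quad_ratio (n \<circ> v) (\<rho> \<circ> v) = quad_ratio (n \<circ> s 0) (\<rho> \<circ> s 0) \<and>
      quad_ratio (n \<circ> v') (\<rho> \<circ> v') * quad_ratio (n \<circ> s 0) (\<rho> \<circ> s 0) = 1 \<and>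
      - 1 / quad_ratio (n \<circ> v) (\<rho> \<circ> v) = quad_ratio (n \<circ> s 1) (\<rho> \<circ> s 1) \<and>
      - 1 / quad_ratio (n \<circ> v') (\<rho> \<circ> v') * quad_ratio (n \<circ> s 1) (\<rho> \<circ> s 1) = 1 \<and>
      quad_ratio (n \<circ> v) (\<rho> \<circ> v) = quad_ratio (n \<circ> s 2) (\<rho> \<circ> s 2) \<and>
      quad_ratio (n \<circ> v') (\<rho> \<circ> v') * quad_ratio (n \<circ> s 2) (\<rho> \<circ> s 2) = 1 \<and>
      - 1 / quad_ratio (n \<circ> v) (\<rho> \<circ> v) = quad_ratio (n \<circ> s 3) (\<rho> \<circ> s 3) \<and>
      - 1 / quad_ratio (n \<circ> v') (\<rho> \<circ> v') * quad_ratio (n \<circ> s 3) (\<rho> \<circ> s 3) = 1"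
    unfolding all_four
    using quad_ratio_shift[OF Lv(1), of "\<rho> \<circ> v"] quad_ratio_shift[OF Lv(2), of "\<rho> \<circ> v'"]
      quad_ratio_shift_2_3[OF Lv(1), of "\<rho> \<circ> v"] quad_ratio_shift_2_3[OF Lv(2), of "\<rho> \<circ> v'"] r(1,2)
    by (simp add: v_def[symmetric] v'_def[symmetric] comp_def)
  also have "quad_ratio (n \<circ> s 0) (\<rho> \<circ> s 0) = moutard_ratio n \<rho> 1 3 z"
    by (simp add: sides moutard_ratio_def)
  also have "quad_ratio (n \<circ> s 1) (\<rho> \<circ> s 1) = moutard_ratio n \<rho> 2 3 (z + dir 1)"
    by (simp add: sides moutard_ratio_def)
  also have "quad_ratio (n \<circ> s 2) (\<rho> \<circ> s 2) = 1 / moutard_ratio n \<rho> 1 3 (z + dir 2)"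
    using quad_ratio_reflect[OF L(5), of "\<rho> \<circ> corner (z + dir 2) 1 3"] r(5)
    by (simp add: sides moutard_ratio_def comp_def)
  also have "quad_ratio (n \<circ> s 3) (\<rho> \<circ> s 3) = 1 / moutard_ratio n \<rho> 2 3 z"
    using quad_ratio_reflect[OF L(6), of "\<rho> \<circ> corner z 2 3"] r(6)
    by (simp add: sides moutard_ratio_def comp_def)
  finally show ?thesis
    by (simp add: moutard_ratio_def comp_def v_def v'_def)
qed

subsection \<open>Existence of Lelieuvre normals\<close>

definition vertex_normals :: "(4 \<Rightarrow> real^3) \<Rightarrow> (4 \<Rightarrow> real^3) \<Rightarrow> bool" where
  "vertex_normals q N \<longleftrightarrow>
    (\<forall>k. N k \<noteq> 0 \<and> N k \<bullet> (q (k + 1) - q k) = 0 \<and> N (k + 1) \<bullet> (q (k + 1) - q k) = 0)"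

text \<open>The edge is orthogonal to the normals at both ends, hence parallel to their cross
  product. These normals are not parallel, since a common one would be orthogonal to three edges of
  a skew quadrilateral.\<close>

lemma skew_quad_edge_cross:
  assumes "skew_quad q" "vertex_normals q N"
  obtains c where "c \<noteq> 0" "q 1 - q 0 = c *\<^sub>R cross3 (N 1) (N 0)"
proof -
  have nz: "N 0 \<noteq> 0" "N 1 \<noteq> 0"
    and perp: "N 0 \<bullet> (q 1 - q 0) = 0" "N 1 \<bullet> (q 1 - q 0) = 0" "N 1 \<bullet> (q 2 - q 1) = 0"
      "N 0 \<bullet> (q 0 - q 3) = 0"
    using assms(2)[unfolded vertex_normals_def all_four] by simp_all
  have d: "q 1 - q 0 \<noteq> 0"
  proof
    assume "q 1 - q 0 = 0"
    with assms(1) show False by (simp add: skew_quad_iff_triple)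
  qed
  have cnz: "cross3 (N 1) (N 0) \<noteq> 0"
  proof
    assume "cross3 (N 1) (N 0) = 0"
    then obtain e where e: "N 1 = e *\<^sub>R N 0"
      using cross_zero_imp_multiple[OF _ nz(1)] by blast
    with nz(2) have "e \<noteq> 0" by auto
    then have "N 0 = 0"
      using perp e by (intro skew_quad_normal_zero[OF assms(1)]) (auto simp: inner_diff_right)
    with nz(1) show False by simp
  qed
  have "cross3 (q 1 - q 0) (cross3 (N 1) (N 0)) = 0"
    unfolding Lagrange using perp by (simp add: inner_commute)
  then obtain c where c: "q 1 - q 0 = c *\<^sub>R cross3 (N 1) (N 0)"
    using cross_zero_imp_multiple[OF _ cnz] by blast
  with d have "c \<noteq> 0" by auto
  with c show thesis using that by blast
qed

text \<open>This is the compatibility needed to write each \<open>c k\<close> as a product of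
  scalars at the two ends of edge \<open>k\<close>. Pairing the vanishing sum of the edges with
  \<open>N 1\<close> and with \<open>N 3\<close> gives two linear relations between the same two
  determinants; eliminating \<open>B\<close> leaves the claim times \<open>A\<close>.\<close>

lemma skew_quad_edge_coeffs_closed:
  assumes "skew_quad q"
    and c: "\<And>k. q (k + 1) - q k = c k *\<^sub>R cross3 (N (k + 1)) (N k)" "\<And>k. c k \<noteq> 0"
  shows "c 0 * c 2 = c 1 * c 3"
proof -
  have e: "q 1 - q 0 = c 0 *\<^sub>R cross3 (N 1) (N 0)" "q 2 - q 1 = c 1 *\<^sub>R cross3 (N 2) (N 1)"
    "q 3 - q 2 = c 2 *\<^sub>R cross3 (N 3) (N 2)" "q 0 - q 3 = c 3 *\<^sub>R cross3 (N 0) (N 3)"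
    using c(1)[of 0] c(1)[of 1] c(1)[of 2] c(1)[of 3] by simp_all
  define A where "A = N 1 \<bullet> cross3 (N 3) (N 2)"
  define B where "B = N 1 \<bullet> cross3 (N 0) (N 3)"
  have AB: "N 3 \<bullet> cross3 (N 2) (N 1) = A" "N 3 \<bullet> cross3 (N 1) (N 0) = B"
    by (simp_all add: A_def B_def cross3_simps)
  have "N 1 \<bullet> ((q 1 - q 0) + (q 2 - q 1) + (q 3 - q 2) + (q 0 - q 3)) = 0"
    "N 3 \<bullet> ((q 1 - q 0) + (q 2 - q 1) + (q 3 - q 2) + (q 0 - q 3)) = 0" by simp_all
  then have r: "c 2 * A + c 3 * B = 0" "c 0 * B + c 1 * A = 0"
    unfolding e by (simp_all add: inner_add_right dot_cross_self AB flip: A_def B_def)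
  \<comment> \<open>Otherwise \<open>B\<close> vanishes too, and \<open>N 3\<close> is orthogonal to
    three edges. It is then zero, which collapses edge 3.\<close>
  have "A \<noteq> 0"
  proof
    assume "A = 0"
    with r(2) c(2)[of 0] have "B = 0" by simp
    have d: "N 3 \<bullet> (q 1 - q 0) = 0" "N 3 \<bullet> (q 2 - q 1) = 0" "N 3 \<bullet> (q 0 - q 3) = 0"
      unfolding e using AB \<open>A = 0\<close> \<open>B = 0\<close> by (simp_all add: dot_cross_self)
    then have "N 3 = 0"
      by (intro skew_quad_normal_zero[OF assms(1)]) (auto simp: inner_diff_right)
    then have "q 3 - q 0 = 0" using e(4) by simp
    with assms(1) show False by (simp add: skew_quad_iff_triple)
  qed
  have "A * (c 0 * c 2) = c 0 * (c 2 * A + c 3 * B) - c 3 * (c 0 * B + c 1 * A) + A * (c 1 * c 3)"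
    by (simp add: algebra_simps)
  then show ?thesis using \<open>A \<noteq> 0\<close> r by simp
qed

section \<open>Multiplicative integration of edge factors\<close>

lemma int_product_recurrence:
  fixes f :: "int \<Rightarrow> real"
  assumes "b \<noteq> 0" "\<And>m. f m \<noteq> 0"
  obtains F where "F 0 = b" "\<And>m. F m \<noteq> 0" "\<And>m. F m * F (m + 1) = f m"
proof -
  define G where "G = rec_nat b (\<lambda>k y. f (int k) / y)"
  \<comment> \<open>The downward recursion: the edge from -k-1 to -k is labelled by its lower end,
    hence the shift in the argument of \<open>f\<close>.\<close>
  define H where "H = rec_nat b (\<lambda>k y. f (- int k - 1) / y)"
  have G: "G 0 = b" "G (Suc k) = f (int k) / G k" for k by (simp_all add: G_def)
  have H: "H 0 = b" "H (Suc k) = f (- int k - 1) / H k" for k by (simp_all add: H_def)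
  have Gnz: "G k \<noteq> 0" for k by (induction k) (use assms G in auto)
  have Hnz: "H k \<noteq> 0" for k by (induction k) (use assms H in auto)
  define F where "F m = (if m \<ge> 0 then G (nat m) else H (nat (- m)))" for m
  have "F m * F (m + 1) = f m" for m
  proof (cases "m \<ge> 0")
    case True
    then have "F (m + 1) = f m / F m"
      using G(2)[of "nat m"] by (simp add: F_def nat_add_distrib)
    then show ?thesis using True Gnz by (simp add: F_def)
  next
    case False
    then have "Suc (nat (- m - 1)) = nat (- m)" "- int (nat (- m - 1)) - 1 = m" by auto
    then have "F m = f m / H (nat (- m - 1))"
      using H(2)[of "nat (- m - 1)"] False by (simp add: F_def)
    moreover have "F (m + 1) = H (nat (- (m + 1)))"
      using False G(1) H(1) by (cases "m = - 1") (auto simp: F_def)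
    moreover have "- (m + 1) = - m - 1" by simp
    ultimately show ?thesis using Hnz by simp
  qed
  moreover have "F 0 = b" "F m \<noteq> 0" for m
    using G H Gnz Hnz by (auto simp: F_def)
  ultimately show thesis using that by blast
qed

definition lattice_point :: "int \<Rightarrow> int \<Rightarrow> int \<Rightarrow> int^3" where
  "lattice_point a b k = vector [a, b, k]"

lemma lattice_point_nth [simp]:
  "lattice_point a b k $ 1 = a" "lattice_point a b k $ 2 = b" "lattice_point a b k $ 3 = k"
  by (simp_all add: lattice_point_def)

lemma lattice_point_eta: "z = lattice_point (z $ 1) (z $ 2) (z $ 3)"
  by (simp add: vec_eq_iff forall_3)

lemma lattice_point_add_dir:
  "lattice_point a b k + dir 1 = lattice_point (a + 1) b k"
  "lattice_point a b k + dir 2 = lattice_point a (b + 1) k"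
  "lattice_point a b k + dir 3 = lattice_point a b (k + 1)"
  by (simp_all add: vec_eq_iff forall_3 dir_nth)

text \<open>The values are propagated from one vertex along an axis of the lower layer, from there
  along every column, and then up the vertical edges. On all other edges the product is right
  because closure of a quadrilateral transfers it from three edges to the fourth.\<close>

lemma edge_products_integrable:
  fixes c :: "3 \<Rightarrow> int^3 \<Rightarrow> real"
  assumes nz: "\<And>z i. z \<in> two_layers \<Longrightarrow> z + dir i \<in> two_layers \<Longrightarrow> c i z \<noteq> 0"
    and closed: "\<And>z i j. elementary_quad two_layers z i j \<Longrightarrow>
      c i z * c i (z + dir j) = c j z * c j (z + dir i)"
  obtains l where "\<And>z i. z \<in> two_layers \<Longrightarrow> z + dir i \<in> two_layers \<Longrightarrow> l z * l (z + dir i) = c i z"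
proof -
  define p where "p a b = lattice_point a b 0" for a b
  have p: "p a b \<in> two_layers" "p a b \<in> layer 0" "p a b + dir 1 = p (a + 1) b" "p a b + dir 2 = p a (b + 1)"
      "p a b + dir 3 \<in> two_layers" "p a b + dir 3 + dir 1 = p (a + 1) b + dir 3"
      "p a b + dir 3 + dir 2 = p a (b + 1) + dir 3" for a b
    by (simp_all add: p_def two_layers_def layer_def lattice_point_add_dir)
  have c0: "c 1 (p a b) \<noteq> 0" "c 2 (p a b) \<noteq> 0" "c 3 (p a b) \<noteq> 0" for a b
    using nz[OF p(1)] p by auto
  have closed12: "c 1 (p a b) * c 1 (p a (b + 1)) = c 2 (p a b) * c 2 (p (a + 1) b)" for a b
    using closed[of "p a b" 1 2] unfolding elementary_quad_two_layers p(3,4) using p(1) by auto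
  have closed13: "c 1 (p a b) * c 1 (p a b + dir 3) = c 3 (p a b) * c 3 (p (a + 1) b)" for a b
    using closed[of "p a b" 1 3] unfolding elementary_quad_two_layers p(3,4) using p(1,2) by auto
  have closed23: "c 2 (p a b) * c 2 (p a b + dir 3) = c 3 (p a b) * c 3 (p a (b + 1))" for a b
    using closed[of "p a b" 2 3] unfolding elementary_quad_two_layers p(3,4) using p(1,2) by auto
  obtain R where R: "R 0 = 1" "\<And>a. R a \<noteq> 0" "\<And>a. R a * R (a + 1) = c 1 (p a 0)"
    using int_product_recurrence[of 1 "\<lambda>a. c 1 (p a 0)"] c0 by auto
  have "\<exists>F. F 0 = R a \<and> (\<forall>b. F b \<noteq> 0) \<and> (\<forall>b. F b * F (b + 1) = c 2 (p a b))" for a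
    using int_product_recurrence[of "R a" "\<lambda>b. c 2 (p a b)"] c0 R by metis
  then obtain F where F: "\<And>a. F a 0 = R a" "\<And>a b. F a b \<noteq> 0" "\<And>a b. F a b * F a (b + 1) = c 2 (p a b)"
    by metis
  have F1: "F a b * F (a + 1) b = c 1 (p a b)" for a b
  proof (induction b rule: int_induct[of _ 0])
    case base
    then show ?case using F(1) R by simp
  next
    case (step1 b)
    have "(F a b * F (a + 1) b) * (F a (b + 1) * F (a + 1) (b + 1)) = c 2 (p a b) * c 2 (p (a + 1) b)"
      unfolding F(3)[symmetric] by simp
    also have "\<dots> = c 1 (p a b) * c 1 (p a (b + 1))" by (simp add: closed12)
    finally show ?case using step1(2) c0 by simp
  next
    case (step2 b)
    have "(F a b * F (a + 1) b) * (F a (b - 1) * F (a + 1) (b - 1)) = c 2 (p a (b - 1)) * c 2 (p (a + 1) (b - 1))"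
      unfolding F(3)[symmetric] by simp
    also have "\<dots> = c 1 (p a (b - 1)) * c 1 (p a b)" using closed12[of a "b - 1"] by simp
    finally show ?case using step2(2) c0 by simp
  qed
  define l where "l z = (if z $ 3 = 0 then F (z $ 1) (z $ 2)
      else c 3 (p (z $ 1) (z $ 2)) / F (z $ 1) (z $ 2))" for z :: "int^3"
  have l: "l (p a b) = F a b" "l (p a b + dir 3) = c 3 (p a b) / F a b" for a b
    by (simp_all add: l_def p_def dir_nth)
  have "l z * l (z + dir i) = c i z" if z: "z \<in> two_layers" "z + dir i \<in> two_layers" for z i
  proof -
    define a b where "a = z $ 1" and "b = z $ 2"
    consider "z = p a b" | "z = p a b + dir 3"
      using z(1) unfolding two_layers_def
      by (subst (asm) (1 2) lattice_point_eta[of z]) (auto simp: a_def b_def p_def lattice_point_add_dir vec_eq_iff forall_3)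
    then show ?thesis
    proof cases
      case 1
      consider "i = 1" | "i = 2" | "i = 3" using exhaust_3 by blast
      then show ?thesis
        by cases (use 1 l p F F1 in auto)
    next
      case 2
      then have "i \<noteq> 3" using z(2) by (auto simp: two_layers_def p_def dir_nth)
      then consider "i = 1" | "i = 2" using exhaust_3 by blast
      then show ?thesis
      proof cases
        case i: 1
        have "l z * l (z + dir i) = c 3 (p a b) * c 3 (p (a + 1) b) / (F a b * F (a + 1) b)"
          by (simp add: 2 i p l)
        also have "\<dots> = c 1 (p a b + dir 3)"
          unfolding F1 closed13[symmetric] using c0 by simp
        finally show ?thesis by (simp add: 2 i)
      next
        case i: 2
        have "l z * l (z + dir i) = c 3 (p a b) * c 3 (p a (b + 1)) / (F a b * F a (b + 1))"
          by (simp add: 2 i p l)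
        also have "\<dots> = c 2 (p a b + dir 3)"
          unfolding F(3) closed23[symmetric] using c0 by simp
        finally show ?thesis by (simp add: 2 i)
      qed
    qed
  qed
  then show thesis using that by blast
qed

lemma lelieuvre_normal_field_exists:
  assumes A: "A_net two_layers x"
  obtains n where "lelieuvre_normal_field two_layers x n"
proof -
  have "\<exists>N. N \<noteq> 0 \<and> (\<forall>i. (z + dir i \<in> two_layers \<longrightarrow> N \<bullet> (x (z + dir i) - x z) = 0) \<and>
      (z - dir i \<in> two_layers \<longrightarrow> N \<bullet> (x z - x (z - dir i)) = 0))" if "z \<in> two_layers" for z
  proof -
    have "coplanar (vertex_star two_layers x z)" using A that by (simp add: A_net_def)
    then obtain N c where N: "N \<noteq> 0" "\<And>q. q \<in> vertex_star two_layers x z \<Longrightarrow> N \<bullet> q = c"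
      using coplanar_imp_hyperplane by metis
    have "x z \<in> vertex_star two_layers x z"
        "z + dir i \<in> two_layers \<Longrightarrow> x (z + dir i) \<in> vertex_star two_layers x z"
        "z - dir i \<in> two_layers \<Longrightarrow> x (z - dir i) \<in> vertex_star two_layers x z" for i
      by (auto simp: vertex_star_def)
    with N show ?thesis by (intro exI[of _ N]) (auto simp: inner_diff_right)
  qed
  then obtain N where N: "\<And>z. z \<in> two_layers \<Longrightarrow> N z \<noteq> 0"
      "\<And>z i. z \<in> two_layers \<Longrightarrow> z + dir i \<in> two_layers \<Longrightarrow> N z \<bullet> (x (z + dir i) - x z) = 0"
      "\<And>z i. z \<in> two_layers \<Longrightarrow> z - dir i \<in> two_layers \<Longrightarrow> N z \<bullet> (x z - x (z - dir i)) = 0"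
    by metis
  have N': "N (z + dir i) \<bullet> (x (z + dir i) - x z) = 0" if "z \<in> two_layers" "z + dir i \<in> two_layers" for z i
    using N(3)[of "z + dir i" i] that by simp
  have skew: "skew_quad (x \<circ> corner z i j)" if "elementary_quad two_layers z i j" for z i j
    using A that by (simp add: A_net_def)
  have normals: "vertex_normals (x \<circ> corner z i j) (N \<circ> corner z i j)"
    if "elementary_quad two_layers z i j" for z i j
  proof -
    have D: "z \<in> two_layers" "z + dir i \<in> two_layers" "z + dir i + dir j \<in> two_layers" "z + dir j \<in> two_layers"
      using that by (auto simp: elementary_quad_def range_four)
    have eq: "z + dir j + dir i = z + dir i + dir j" by (simp add: add_ac)
    have flip: "u \<bullet> (v - w) = 0 \<longleftrightarrow> u \<bullet> (w - v) = 0" for u v w :: "real^3"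
      by (auto simp: inner_diff_right)
    have "N (z + dir j) \<bullet> (x (z + dir j) - x (z + dir i + dir j)) = 0"
      "N (z + dir i + dir j) \<bullet> (x (z + dir j) - x (z + dir i + dir j)) = 0"
      using N(2)[of "z + dir j" i] N'[of "z + dir j" i] D unfolding eq flip[of _ "x (z + dir j)"] by auto
    moreover have "N (z + dir j) \<bullet> (x z - x (z + dir j)) = 0" "N z \<bullet> (x z - x (z + dir j)) = 0"
      using N(2)[of z j] N'[of z j] D unfolding flip[of _ "x z"] by auto
    ultimately show ?thesis
      unfolding vertex_normals_def all_four
      using D N(1,2) N' by simp
  qed
  have edge: "\<exists>c. z \<in> two_layers \<and> z + dir i \<in> two_layers \<longrightarrow>
      c \<noteq> 0 \<and> x (z + dir i) - x z = c *\<^sub>R cross3 (N (z + dir i)) (N z)" for i z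
  proof (cases "z \<in> two_layers \<and> z + dir i \<in> two_layers")
    case True
    \<comment> \<open>Every edge must lie in some elementary quadrilateral. A second direction
      within the layer always exists, and a vertical edge automatically starts in the lower
      layer.\<close>
    define j :: 3 where "j = (if i = 1 then 2 else 1)"
    have "elementary_quad two_layers z i j"
      using True unfolding elementary_quad_two_layers j_def
      by (auto simp: two_layers_def layer_def dir_nth split: if_splits)
    from skew_quad_edge_cross[OF skew normals, OF this this] show ?thesis by auto
  qed blast
  have "\<exists>c. \<forall>i z. z \<in> two_layers \<and> z + dir i \<in> two_layers \<longrightarrow>
      c i z \<noteq> 0 \<and> x (z + dir i) - x z = c i z *\<^sub>R cross3 (N (z + dir i)) (N z)"
    by (rule choice, rule allI, rule choice, rule allI, rule edge)
  then obtain c where c: "\<And>z i. z \<in> two_layers \<Longrightarrow> z + dir i \<in> two_layers \<Longrightarrow> c i z \<noteq> 0"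
      "\<And>z i. z \<in> two_layers \<Longrightarrow> z + dir i \<in> two_layers \<Longrightarrow>
        x (z + dir i) - x z = c i z *\<^sub>R cross3 (N (z + dir i)) (N z)"
    by blast
  have c': "x z - x (z + dir i) = c i z *\<^sub>R cross3 (N z) (N (z + dir i))"
    if "z \<in> two_layers" "z + dir i \<in> two_layers" for z i
    using c(2)[OF that] cross_skew[of "N z"] by (metis minus_diff_eq scaleR_minus_right)
  have "c i z * c i (z + dir j) = c j z * c j (z + dir i)" if q: "elementary_quad two_layers z i j" for z i j
  proof -
    have D: "z \<in> two_layers" "z + dir i \<in> two_layers" "z + dir i + dir j \<in> two_layers" "z + dir j \<in> two_layers"
      using q by (auto simp: elementary_quad_def range_four)
    \<comment> \<open>Edges 2 and 3 are traversed backwards, but reversal also swaps the cross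
      product, so the coefficients of the lattice edges carry over without a sign.\<close>
    define d :: "4 \<Rightarrow> real" where "d k = (if k = 0 then c i z else if k = 1 then c j (z + dir i)
        else if k = 2 then c i (z + dir j) else c j z)" for k
    have eq: "z + dir j + dir i = z + dir i + dir j" by (simp add: add_ac)
    have "x (z + dir j) - x (z + dir i + dir j)
        = c i (z + dir j) *\<^sub>R cross3 (N (z + dir j)) (N (z + dir i + dir j))"
      using c'[of "z + dir j" i] D unfolding eq by auto
    then have "\<forall>k. (x \<circ> corner z i j) (k + 1) - (x \<circ> corner z i j) k =
        d k *\<^sub>R cross3 ((N \<circ> corner z i j) (k + 1)) ((N \<circ> corner z i j) k)"
      unfolding all_four using c(2) c'[of z j] D by (simp add: d_def)
    moreover have "\<forall>k. d k \<noteq> 0"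
      unfolding all_four using c(1)[of z] c(1)[of "z + dir i" j] c(1)[of "z + dir j" i] D
      by (simp add: d_def eq)
    ultimately have "d 0 * d 2 = d 1 * d 3"
      using skew_quad_edge_coeffs_closed[OF skew[OF q], of d "N \<circ> corner z i j"] by blast
    then show ?thesis by (simp add: d_def mult.commute)
  qed
  from edge_products_integrable[OF c(1) this]
  obtain l where l: "\<And>z i. z \<in> two_layers \<Longrightarrow> z + dir i \<in> two_layers \<Longrightarrow> l z * l (z + dir i) = c i z"
    by blast
  have "lelieuvre_normal_field two_layers x (\<lambda>z. l z *\<^sub>R N z)"
    unfolding lelieuvre_normal_field_def
    using c(2) l by (simp add: cross_mult_left cross_mult_right mult.commute)
  then show thesis using that by blast
qed

subsection \<open>Weingarten pairs\<close>

lemma two_layers_eq: "two_layers = layer 0 \<union> layer 1"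
  by (auto simp: two_layers_def layer_def)

text \<open>The layers supply reciprocity along horizontal edges, the cubes the rest. Conversely,
  inside one cube all ratios are \<open>t\<close>, \<open>- t\<close> or their inverses for a single
  \<open>t\<close>, and the cube equations become identities.\<close>

lemma weingarten_pair_iff:
  assumes x: "crisscrossed_A_net two_layers x \<rho>" and n: "lelieuvre_normal_field two_layers x n"
  shows "weingarten_pair x \<rho> \<longleftrightarrow>
    (\<forall>z i. z \<in> two_layers \<and> z + dir i \<in> two_layers \<longrightarrow>
      moutard_ratio n \<rho> 1 2 z * moutard_ratio n \<rho> 1 2 (z + dir i) = 1) \<and>
    (\<forall>z\<in>layer 0. moutard_ratio n \<rho> 1 3 z = moutard_ratio n \<rho> 1 2 z \<and>
      moutard_ratio n \<rho> 2 3 z = - moutard_ratio n \<rho> 1 2 z)"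
    (is "_ \<longleftrightarrow> ?edges \<and> ?sides")
proof -
  define g where "g = moutard_ratio n \<rho>"
  have A: "A_net two_layers x" using x by (simp add: crisscrossed_A_net_def)
  have step: "z + dir 1 \<in> layer k" "z + dir 2 \<in> layer k" if "z \<in> layer k" for z k
    using that by (auto simp: layer_def dir_nth)
  have step3: "z + dir 3 \<in> layer 1" if "z \<in> layer 0" for z
    using that by (auto simp: layer_def dir_nth)
  have edges: "?edges \<longleftrightarrow> (\<forall>z\<in>two_layers. g 1 2 z * g 1 2 (z + dir 1) = 1 \<and> g 1 2 z * g 1 2 (z + dir 2) = 1)
      \<and> (\<forall>z\<in>layer 0. g 1 2 z * g 1 2 (z + dir 3) = 1)" (is "_ \<longleftrightarrow> ?E")
  proof
    assume ?edges
    then show ?E using step step3 unfolding two_layers_eq g_def by blast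
  next
    assume E: ?E
    show ?edges
      unfolding g_def[symmetric]
    proof (intro allI impI)
      fix z i assume z: "z \<in> two_layers \<and> z + dir i \<in> two_layers"
      then have "z \<in> layer 0" if "i = 3"
        using that by (auto simp: two_layers_def layer_def dir_nth)
      moreover have "i = 1 \<or> i = 2 \<or> i = 3" by (rule exhaust_3)
      ultimately show "g 1 2 z * g 1 2 (z + dir i) = 1" using E z by auto
    qed
  qed
  have pre: "pre_hyperbolic_net k x \<rho> \<longleftrightarrow>
      (\<forall>z\<in>layer k. g 1 2 z * g 1 2 (z + dir 1) = 1 \<and> g 1 2 z * g 1 2 (z + dir 2) = 1)"
    if "k \<in> {0, 1}" for k
    using pre_hyperbolic_net_iff[OF x n that] by (simp add: g_def)
  note cube = weingarten_cube_iff[OF x n, folded g_def]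
  show ?thesis
  proof
    assume w: "weingarten_pair x \<rho>"
    then have "\<forall>z\<in>two_layers. g 1 2 z * g 1 2 (z + dir 1) = 1 \<and> g 1 2 z * g 1 2 (z + dir 2) = 1"
      using pre unfolding weingarten_pair_def two_layers_eq by blast
    moreover have c: "g 1 2 z = g 1 3 z \<and> g 1 2 (z + dir 3) * g 1 3 z = 1 \<and> - 1 / g 1 2 z = 1 / g 2 3 z"
      if "z \<in> layer 0" for z
      using w that cube[OF that] unfolding weingarten_pair_def by blast
    moreover have "g 2 3 z = - g 1 2 z" if "z \<in> layer 0" for z
    proof -
      \<comment> \<open>As \<open>1 / 0 = 0\<close>, nonvanishing must precede clearing
        denominators: \<open>g 1 2 z\<close> is a factor of a product equal to 1, and then the equal
        fractions force \<open>g 2 3 z\<close> to be nonzero.\<close>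
      have "g 1 2 z \<noteq> 0" using c[OF that] by auto
      moreover from this have "g 2 3 z \<noteq> 0" using c[OF that] by auto
      ultimately have "- 1 * g 2 3 z = 1 * g 1 2 z"
        using c[OF that] by (metis frac_eq_eq)
      then show ?thesis by simp
    qed
    \<comment> \<open>Eliminating the side ratio from two cube equations yields reciprocity along
      the vertical edge.\<close>
    moreover have "g 1 2 z * g 1 2 (z + dir 3) = 1" if "z \<in> layer 0" for z
      using c[OF that] by (simp add: mult.commute)
    ultimately show "?edges \<and> ?sides"
      unfolding edges unfolding g_def[symmetric] by simp
  next
    assume "?edges \<and> ?sides"
    then have e: "\<And>z. z \<in> two_layers \<Longrightarrow> g 1 2 z * g 1 2 (z + dir 1) = 1"
        "\<And>z. z \<in> two_layers \<Longrightarrow> g 1 2 z * g 1 2 (z + dir 2) = 1"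
        "\<And>z. z \<in> layer 0 \<Longrightarrow> g 1 2 z * g 1 2 (z + dir 3) = 1"
      and s: "\<And>z. z \<in> layer 0 \<Longrightarrow> g 1 3 z = g 1 2 z" "\<And>z. z \<in> layer 0 \<Longrightarrow> g 2 3 z = - g 1 2 z"
      unfolding edges by (auto simp: g_def)
    have "pre_hyperbolic_net k x \<rho>" if "k \<in> {0, 1}" for k
      using pre[OF that] e(1,2) layer_subset_two_layers[OF that] by blast
    moreover have "weingarten_cube (x \<circ> corner z 1 2) (quad_cross x \<rho> z 1 2)
        (x \<circ> corner (z + dir 3) 1 2) (quad_cross x \<rho> (z + dir 3) 1 2)" if z: "z \<in> layer 0" for z
    proof -
      define t where "t = g 1 2 z"
      have e: "t * g 1 2 (z + dir 1) = 1" "t * g 1 2 (z + dir 2) = 1" "t * g 1 2 (z + dir 3) = 1"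
        using e z by (auto simp: two_layers_eq t_def)
      then have t: "t \<noteq> 0" by auto
      with e have e: "g 1 2 (z + dir 1) = 1 / t" "g 1 2 (z + dir 2) = 1 / t" "g 1 2 (z + dir 3) = 1 / t"
        by (simp_all add: field_simps)
      show ?thesis
        unfolding cube[OF z] s(1)[OF z] s(2)[OF z] s(1)[OF step(2)[OF z]] s(2)[OF step(1)[OF z]] e
          t_def[symmetric]
        using t by simp
    qed
    ultimately show "weingarten_pair x \<rho>"
      using A by (simp add: weingarten_pair_def)
  qed
qed

lemma two_layers_invariant_constant:
  assumes \<phi>: "\<And>z i. z \<in> two_layers \<Longrightarrow> z + dir i \<in> two_layers \<Longrightarrow> \<phi> (z + dir i) = \<phi> z"
    and z: "z \<in> two_layers"
  shows "\<phi> z = \<phi> 0"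
proof -
  define p where "p = lattice_point"
  have in2: "p a b k \<in> two_layers" if "k \<in> {0, 1}" for a b k
    using that by (auto simp: two_layers_def p_def)
  have step: "\<phi> (p (a + 1) b k) = \<phi> (p a b k)" "\<phi> (p a (b + 1) k) = \<phi> (p a b k)" if "k \<in> {0, 1}" for a b k
    using \<phi>[of "p a b k" 1] \<phi>[of "p a b k" 2] in2[OF that] by (simp_all add: p_def lattice_point_add_dir)
  have "\<phi> (p a b k) = \<phi> (p a 0 k)" if "k \<in> {0, 1}" for a b k
    by (induction b rule: int_induct[of _ 0]) (use step(2)[OF that, of a] in \<open>auto\<close>, metis diff_add_cancel)
  moreover have "\<phi> (p a 0 k) = \<phi> (p 0 0 k)" if "k \<in> {0, 1}" for a k
    by (induction a rule: int_induct[of _ 0]) (use step(1)[OF that, of _ 0] in \<open>auto\<close>, metis diff_add_cancel)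
  moreover have "\<phi> (p 0 0 1) = \<phi> (p 0 0 0)"
    using \<phi>[of "p 0 0 0" 3] in2[of 0] in2[of 1] by (simp add: p_def lattice_point_add_dir)
  moreover have "p 0 0 0 = 0"
    by (simp add: p_def vec_eq_iff forall_3)
  moreover have "z = p (z $ 1) (z $ 2) (z $ 3)"
    unfolding p_def by (rule lattice_point_eta)
  moreover have "z $ 3 \<in> {0, 1}" using z by (simp add: two_layers_def)
  ultimately show ?thesis by (metis insertE singletonD)
qed

text \<open>One diagonal of the normals is multiplied by \<open>t\<close> and the other by
  \<open>1 / t\<close>, so their quotient picks up a square: the sign of the ratio is
  invariant.\<close>

lemma moutard_ratio_rescale:
  assumes L: "lelieuvre_quad (x \<circ> corner z i j) (n \<circ> corner z i j)"
    and s: "s z = t" "s (z + dir i + dir j) = t" "s (z + dir i) = 1 / t" "s (z + dir j) = 1 / t" "t \<noteq> 0"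
  shows "moutard_ratio (\<lambda>z. s z *\<^sub>R n z) \<rho> i j z = t\<^sup>2 * moutard_ratio n \<rho> i j z"
proof -
  have M: "n (z + dir i + dir j) - n z = quad_moutard (n \<circ> corner z i j) *\<^sub>R (n (z + dir j) - n (z + dir i))"
      "n (z + dir j) \<noteq> n (z + dir i)"
    using lelieuvre_quad_moutard(3,4)[OF L] by simp_all
  have "quad_moutard ((\<lambda>z. s z *\<^sub>R n z) \<circ> corner z i j) = t\<^sup>2 * quad_moutard (n \<circ> corner z i j)"
  proof (rule quad_moutard_eqI)
    show "((\<lambda>z. s z *\<^sub>R n z) \<circ> corner z i j) 3 \<noteq> ((\<lambda>z. s z *\<^sub>R n z) \<circ> corner z i j) 1"
      using M(2) s by simp
    have "t *\<^sub>R (n (z + dir i + dir j) - n z)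
        = (t\<^sup>2 * quad_moutard (n \<circ> corner z i j)) *\<^sub>R ((1 / t) *\<^sub>R (n (z + dir j) - n (z + dir i)))"
      unfolding M(1) using s(5) by (simp add: power2_eq_square)
    then show "((\<lambda>z. s z *\<^sub>R n z) \<circ> corner z i j) 2 - ((\<lambda>z. s z *\<^sub>R n z) \<circ> corner z i j) 0 =
      (t\<^sup>2 * quad_moutard (n \<circ> corner z i j)) *\<^sub>R
        (((\<lambda>z. s z *\<^sub>R n z) \<circ> corner z i j) 3 - ((\<lambda>z. s z *\<^sub>R n z) \<circ> corner z i j) 1)"
      using s by (simp add: scaleR_right_diff_distrib)
  qed
  then show ?thesis by (simp add: moutard_ratio_def quad_ratio_def)
qed

theorem theorem44:
  fixes x :: "int^3 \<Rightarrow> real^3" and \<rho> :: "int^3 \<Rightarrow> real"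
  assumes "crisscrossed_A_net two_layers x \<rho>"
  shows "weingarten_pair x \<rho> \<longleftrightarrow>
    (\<exists>n. lelieuvre_normal_field two_layers x n \<and>
       (parametrizes_moutard two_layers \<rho> n {(2, 1), (2, 3), (3, 1)} \<or>
        parametrizes_moutard two_layers \<rho> n {(1, 2), (3, 2), (1, 3)}))"
proof -
  have A: "A_net two_layers x" and \<rho>: "\<forall>z\<in>two_layers. \<rho> z \<noteq> 0"
    using assms by (auto simp: crisscrossed_A_net_def)
  have swap: "moutard_ratio n \<rho> j i z = - moutard_ratio n \<rho> i j z"
    if "lelieuvre_normal_field two_layers x n" "elementary_quad two_layers z i j" for n i j z
  proof -
    have "\<rho> (corner z i j k) \<noteq> 0" for k
      using \<rho> that(2) by (auto simp: elementary_quad_def)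
    then show ?thesis
      using moutard_ratio_swap[OF lelieuvre_quad_corner[OF that A]] by blast
  qed
  have q: "elementary_quad two_layers z 1 2 \<longleftrightarrow> z \<in> two_layers" "elementary_quad two_layers z 2 1 \<longleftrightarrow> z \<in> two_layers"
    "elementary_quad two_layers z 1 3 \<longleftrightarrow> z \<in> layer 0" "elementary_quad two_layers z 3 1 \<longleftrightarrow> z \<in> layer 0"
    "elementary_quad two_layers z 2 3 \<longleftrightarrow> z \<in> layer 0" "elementary_quad two_layers z 3 2 \<longleftrightarrow> z \<in> layer 0" for z
    using two_layers_eq by (auto simp: elementary_quad_two_layers)
  have param: "parametrizes_moutard two_layers \<rho> n {(2, 1), (2, 3), (3, 1)} \<longleftrightarrow>
      (\<forall>z\<in>two_layers. moutard_ratio n \<rho> 1 2 z = - 1) \<and>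
      (\<forall>z\<in>layer 0. moutard_ratio n \<rho> 1 3 z = - 1 \<and> moutard_ratio n \<rho> 2 3 z = 1)"
    "parametrizes_moutard two_layers \<rho> n {(1, 2), (3, 2), (1, 3)} \<longleftrightarrow>
      (\<forall>z\<in>two_layers. moutard_ratio n \<rho> 1 2 z = 1) \<and>
      (\<forall>z\<in>layer 0. moutard_ratio n \<rho> 1 3 z = 1 \<and> moutard_ratio n \<rho> 2 3 z = - 1)"
    if n: "lelieuvre_normal_field two_layers x n" for n
  proof -
    have "moutard_ratio n \<rho> 2 1 z = - moutard_ratio n \<rho> 1 2 z" if "z \<in> two_layers" for z
      using swap[OF n] q that by blast
    moreover have "moutard_ratio n \<rho> 3 1 z = - moutard_ratio n \<rho> 1 3 z"
        "moutard_ratio n \<rho> 3 2 z = - moutard_ratio n \<rho> 2 3 z" if "z \<in> layer 0" for z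
      using swap[OF n] q that by blast+
    ultimately show "parametrizes_moutard two_layers \<rho> n {(2, 1), (2, 3), (3, 1)} \<longleftrightarrow>
      (\<forall>z\<in>two_layers. moutard_ratio n \<rho> 1 2 z = - 1) \<and>
      (\<forall>z\<in>layer 0. moutard_ratio n \<rho> 1 3 z = - 1 \<and> moutard_ratio n \<rho> 2 3 z = 1)"
      "parametrizes_moutard two_layers \<rho> n {(1, 2), (3, 2), (1, 3)} \<longleftrightarrow>
      (\<forall>z\<in>two_layers. moutard_ratio n \<rho> 1 2 z = 1) \<and>
      (\<forall>z\<in>layer 0. moutard_ratio n \<rho> 1 3 z = 1 \<and> moutard_ratio n \<rho> 2 3 z = - 1)"
      unfolding parametrizes_moutard_iff[OF \<rho>] by (auto simp: q)
  qed
  show ?thesis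
  proof
    assume w: "weingarten_pair x \<rho>"
    obtain n where n: "lelieuvre_normal_field two_layers x n"
      using lelieuvre_normal_field_exists[OF A] by blast
    define g where "g = moutard_ratio n \<rho> 1 2"
    have g: "g z * g (z + dir i) = 1" if "z \<in> two_layers" "z + dir i \<in> two_layers" for z i
      using w that unfolding weingarten_pair_iff[OF assms n] g_def by blast
    \<comment> \<open>The products of \<open>g\<close> along edges are 1, so this rescaling preserves the Lelieuvre
      relation; it turns \<open>g\<close> into its sign, which is constant by connectedness.\<close>
    define s where "s z = 1 / sqrt \<bar>g z\<bar>" for z
    have s: "s z * s (z + dir i) = 1" if "z \<in> two_layers" "z + dir i \<in> two_layers" for z i
      using g[OF that] by (simp add: s_def flip: real_sqrt_mult abs_mult)
    define m where "m z = s z *\<^sub>R n z" for z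
    have m: "lelieuvre_normal_field two_layers x m"
      using n s unfolding lelieuvre_normal_field_def m_def
      by (simp add: cross_mult_left cross_mult_right mult.commute)
    have sgn: "moutard_ratio m \<rho> 1 2 z = sgn (g z)" if z: "z \<in> two_layers" for z
    proof -
      have D: "z + dir 1 \<in> two_layers" "z + dir 2 \<in> two_layers" "z + dir 1 + dir 2 \<in> two_layers"
        using z by (auto simp: two_layers_def dir_nth)
      have "s z \<noteq> 0" using s[OF z D(1)] by auto
      have "g z \<noteq> 0" using g[OF z D(1)] by auto
      have st: "s (z + dir 1) = 1 / s z" "s (z + dir 2) = 1 / s z"
        using s[OF z D(1)] s[OF z D(2)] \<open>s z \<noteq> 0\<close> by (auto simp: field_simps)
      \<comment> \<open>Two steps invert the factor twice, so opposite corners are scaled alike, as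
        rescaling requires.\<close>
      have "s (z + dir 1) * s (z + dir 1 + dir 2) = s (z + dir 1) * s z"
        using s[OF z D(1)] s[OF D(1,3)] by (simp add: mult.commute)
      then have st3: "s (z + dir 1 + dir 2) = s z" using st(1) \<open>s z \<noteq> 0\<close> by simp
      have "elementary_quad two_layers z 1 2" using q z by simp
      from moutard_ratio_rescale[OF lelieuvre_quad_corner[OF n this A] refl st3 st \<open>s z \<noteq> 0\<close>, of \<rho>]
      have "moutard_ratio m \<rho> 1 2 z = (s z)\<^sup>2 * g z"
        by (simp add: m_def[abs_def] g_def)
      also have "\<dots> = sgn (g z)"
        using \<open>g z \<noteq> 0\<close> by (simp add: s_def power_divide sgn_if)
      finally show ?thesis .
    qed
    have "sgn (g z) = sgn (g 0)" if "z \<in> two_layers" for z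
    proof (rule two_layers_invariant_constant[OF _ that])
      fix z i assume "z \<in> two_layers" "z + dir i \<in> two_layers"
      then have "g z * g (z + dir i) > 0" using g by simp
      then show "sgn (g (z + dir i)) = sgn (g z)"
        by (auto simp: zero_less_mult_iff)
    qed
    with sgn have const: "moutard_ratio m \<rho> 1 2 z = sgn (g 0)" if "z \<in> two_layers" for z
      using that by simp
    \<comment> \<open>This excludes the third value 0 of the sign.\<close>
    have "g 0 * g (0 + dir 1) = 1" by (rule g) (simp_all add: two_layers_def dir_nth)
    then have "sgn (g 0) = 1 \<or> sgn (g 0) = - 1" by (auto simp: sgn_if)
    \<comment> \<open>Being a Weingarten pair does not refer to normals, so the characterization may
      be applied again to the rescaled field \<open>m\<close>.\<close>
    moreover have "moutard_ratio m \<rho> 1 3 z = sgn (g 0) \<and> moutard_ratio m \<rho> 2 3 z = - sgn (g 0)" if "z \<in> layer 0" for z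
      using w that const two_layers_eq unfolding weingarten_pair_iff[OF assms m] by auto
    ultimately show "\<exists>n. lelieuvre_normal_field two_layers x n \<and>
       (parametrizes_moutard two_layers \<rho> n {(2, 1), (2, 3), (3, 1)} \<or>
        parametrizes_moutard two_layers \<rho> n {(1, 2), (3, 2), (1, 3)})"
      using const param[OF m] m by auto
  next
    assume "\<exists>n. lelieuvre_normal_field two_layers x n \<and>
       (parametrizes_moutard two_layers \<rho> n {(2, 1), (2, 3), (3, 1)} \<or>
        parametrizes_moutard two_layers \<rho> n {(1, 2), (3, 2), (1, 3)})"
    then obtain n where n: "lelieuvre_normal_field two_layers x n"
      and "parametrizes_moutard two_layers \<rho> n {(2, 1), (2, 3), (3, 1)} \<or>
        parametrizes_moutard two_layers \<rho> n {(1, 2), (3, 2), (1, 3)}" by blast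
    \<comment> \<open>The constants 1 and -1 are their own inverses, so reciprocity along edges is
      immediate.\<close>
    then show "weingarten_pair x \<rho>"
      unfolding param[OF n] weingarten_pair_iff[OF assms n]
      using layer_subset_two_layers[of 0] by (elim disjE) (auto simp: subset_iff)
  qed
qed

end
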